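(* Let $p\ge 3$ be a fixed integer and let $\widehat{K_n}$ be the graph obtained from $K_n$ by subdividing each edge by one vertex. Then $\widehat{K_n}$ is $p$-good for all sufficiently large $n$.
   Context: All graphs are finite and simple. The Ramsey number $r(H_1,H_2)$ is the least $m$ such that for every partition $E(K_m)=E(R)\cup E(B)$ into the edge sets of two graphs $R,B$ on $V(K_m)$, either $H_1\subset R$ or $H_2\subset B$. A connected graph $H$ is $p$-good if $r(K_p,H)=(p-1)(|H|-1)+1$, where $|H|$ is the order of $H$. *)

theory Defs
  imports Main "HOL-Library.Ramsey"
begin

record 'a sgraph =
  verts :: "'a set"
  edges :: "'a set set"

definition simple_graph :: "'a sgraph \<Rightarrow> bool" where
  "simple_graph G \<longleftrightarrow> finite (verts G) \<and> edges G \<subseteq> [verts G]\<^bsup>2\<^esup>"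

definition graph_order :: "'a sgraph \<Rightarrow> nat" where
  "graph_order G = card (verts G)"

definition connected_graph :: "'a sgraph \<Rightarrow> bool" where
  "connected_graph G \<longleftrightarrow> verts G \<noteq> {} \<and>
     (\<forall>u\<in>verts G. \<forall>v\<in>verts G. (u, v) \<in> {(x, y). {x, y} \<in> edges G}\<^sup>*)"

text \<open>\<open>H\<close> is contained in \<open>G\<close> if \<open>G\<close> has a (not necessarily induced) subgraph isomorphic to \<open>H\<close>.\<close>

definition contains_graph :: "'a sgraph \<Rightarrow> 'b sgraph \<Rightarrow> bool" where
  "contains_graph G H \<longleftrightarrow>
     (\<exists>f. inj_on f (verts H) \<and> f ` verts H \<subseteq> verts G \<and> (\<forall>e\<in>edges H. f ` e \<in> edges G))"

definition complete_graph :: "nat \<Rightarrow> nat sgraph" where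
  "complete_graph n = \<lparr>verts = {..<n}, edges = [{..<n}]\<^bsup>2\<^esup>\<rparr>"

definition subdivide_edges :: "'a sgraph \<Rightarrow> ('a + 'a set) sgraph" where
  "subdivide_edges G =
     \<lparr>verts = Inl ` verts G \<union> Inr ` edges G,
      edges = {{Inl v, Inr e} | v e. e \<in> edges G \<and> v \<in> e}\<rparr>"

definition ramsey_property :: "'a sgraph \<Rightarrow> 'b sgraph \<Rightarrow> nat \<Rightarrow> bool" where
  "ramsey_property H1 H2 m \<longleftrightarrow>
     (\<forall>R B :: nat sgraph.
        verts R = verts (complete_graph m) \<and> verts B = verts (complete_graph m) \<and>
        edges R \<union> edges B = edges (complete_graph m) \<and> edges R \<inter> edges B = {} \<longrightarrow>
        contains_graph R H1 \<or> contains_graph B H2)"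

definition ramsey_number :: "'a sgraph \<Rightarrow> 'b sgraph \<Rightarrow> nat" where
  "ramsey_number H1 H2 = (LEAST m. ramsey_property H1 H2 m)"

definition p_good :: "nat \<Rightarrow> 'a sgraph \<Rightarrow> bool" where
  "p_good p H \<longleftrightarrow> simple_graph H \<and> connected_graph H \<and>
     ramsey_number (complete_graph p) H = (p - 1) * (graph_order H - 1) + 1"

text \<open>For finite simple graphs the set of admissible \<open>m\<close> in the definition of the Ramsey number is
  nonempty, so \<open>LEAST\<close> returns a genuine minimum.\<close>

lemma contains_graph_if_clique:
  assumes H: "simple_graph H" and S: "S \<subseteq> verts G" "finite S" "card S = graph_order H"
    and cl: "clique S (edges G)"
  shows "contains_graph G H"
proof -
  obtain f where f: "bij_betw f (verts H) S"
    using H S finite_same_card_bij unfolding simple_graph_def graph_order_def by metis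
  have "f ` e \<in> edges G" if "e \<in> edges H" for e
  proof -
    obtain x y where xy: "e = {x, y}" "x \<in> verts H" "y \<in> verts H" "x \<noteq> y"
      using \<open>e \<in> edges H\<close> H unfolding simple_graph_def by (meson nsets2_E subsetD)
    then have "f x \<in> S" "f y \<in> S" "f x \<noteq> f y"
      using f by (auto simp: bij_betw_def inj_on_def)
    then show ?thesis
      using cl xy(1) by (auto simp: clique_def)
  qed
  then show ?thesis
    using f S(1) unfolding contains_graph_def bij_betw_def by blast
qed

lemma ramsey_property_ex:
  assumes "simple_graph H1" "simple_graph H2"
  shows "\<exists>m. ramsey_property H1 H2 m"
proof -
  obtain r where r: "\<And>(V::nat set) E. finite V \<Longrightarrow> card V \<ge> r \<Longrightarrow>
      \<exists>S \<subseteq> V. card S = graph_order H1 \<and> clique S E \<or> card S = graph_order H2 \<and> indep S E"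
    using ramsey2[of "graph_order H1" "graph_order H2", where 'a = nat] by metis
  have "contains_graph R H1 \<or> contains_graph B H2"
    if RB: "verts R = {..<r}" "verts B = {..<r}" "edges R \<union> edges B = [{..<r}]\<^bsup>2\<^esup>"
    for R B :: "nat sgraph"
  proof -
    obtain S where S: "S \<subseteq> {..<r}"
      "card S = graph_order H1 \<and> clique S (edges R) \<or> card S = graph_order H2 \<and> indep S (edges R)"
      using r[of "{..<r}" "edges R"] by auto
    have fin: "finite S"
      using S(1) finite_subset by blast
    have "clique S (edges B)" if "indep S (edges R)"
      unfolding clique_def
    proof (intro ballI impI)
      fix v w assume vw: "v \<in> S" "w \<in> S" "v \<noteq> w"
      then have "{v, w} \<in> [{..<r}]\<^bsup>2\<^esup>"
        using S(1) by auto
      then show "{v, w} \<in> edges B"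
        using RB(3) that vw unfolding indep_def by blast
    qed
    then show ?thesis
      using S fin RB(1,2) assms contains_graph_if_clique by metis
  qed
  then show ?thesis
    unfolding ramsey_property_def complete_graph_def by (intro exI[of _ r]) simp
qed

end

theory Submission
  imports Defs Complex_Main
begin

text \<open>
  Write \<open>N = n + (n choose 2)\<close> for the order of the subdivision of \<open>K\<^sub>n\<close>; a colouring is given by
  its red relation \<open>R\<close>, two distinct vertices that are not red being blue. The lower bound is the
  usual one: the subdivision is connected, so \<open>p - 1\<close> blue cliques of order \<open>N - 1\<close>
  with all red edges between them avoid both graphs.

  For the upper bound, choose a set \<open>S\<close> of \<open>n\<close> branch vertices. A blue subdivision with these branch
  vertices is a system of distinct representatives for the common blue neighbourhoods outside \<open>S\<close> of
  the pairs in \<open>S\<close>. If there is none, Hall's theorem yields a set \<open>F\<close> of pairs and a set \<open>W\<close> of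
  vertices with \<open>|W| + |F| > |V| - n\<close> such that each vertex of \<open>W\<close> is red to an end of each
  pair in \<open>F\<close>. As \<open>|F|\<close> is at most \<open>n choose 2\<close>, removing everything but \<open>W\<close> costs less than \<open>N\<close>
  vertices, and the argument can proceed by induction on the size of the red clique,
  provided that \<open>S\<close> is chosen so well that a red clique in \<open>W\<close> extends into \<open>S\<close> or into the
  set from which \<open>S\<close> was taken.

  The induction carries two statements about a set \<open>V\<close> without blue subdivision. The exact one
  (\<open>red_clique_or_blue_subdiv\<close>) finds a red \<open>K\<^sub>q\<close> once \<open>|V| > (q - 1) (N - 1)\<close>.
  The approximate one (\<open>abundant\<close>) finds a positive proportion of all possible red \<open>K\<^sub>q\<close> once \<open>|V|\<close>
  exceeds \<open>(q - 1) n\<^sup>2 / 2\<close> by a fixed multiple of \<open>n\<^sup>2\<close>. Both follow from \<open>small_blocked_set\<close>: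
  if \<open>V\<close> has few red \<open>K\<^bsub>q+1\<^esub>\<close>, then \<open>S\<close> can be chosen such that its blocked set \<open>W\<close> is too small
  for the approximate statement about \<open>q\<close>. To see this, take \<open>A\<^sub>0\<close> to be the common red neighbourhood
  of a red \<open>K\<^bsub>q-1\<^esub>\<close> that extends to many \<open>K\<^sub>q\<close> but few \<open>K\<^bsub>q+1\<^esub>\<close>; after deletion of some vertices
  \<open>A\<^sub>0\<close> is almost a blue clique of quadratic size (\<open>rich_sparse_subset\<close>), so all its pairs have many common blue
  neighbours and \<open>F\<close> must be large (\<open>violator_has_many_pairs\<close>). An energy increment
  (\<open>regular_subset\<close>) shrinks \<open>A\<^sub>0\<close> to a set \<open>A\<close> such that almost all vertices have nearly the same red
  density in \<open>A\<close> as in any given not too small part of \<open>A\<close>, and \<open>S\<close> is a sample of \<open>A\<close> on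
  which almost all red degrees are right (\<open>sample_subset\<close>). The red neighbours in \<open>S\<close> of a vertex of \<open>W\<close>
  cover \<open>F\<close>, hence almost all vertices of \<open>W\<close> have positive red density in \<open>A\<close>. If \<open>W\<close> were large, it
  would contain many red \<open>K\<^sub>q\<close>, and regularity extends them to many red
  \<open>K\<^bsub>q+1\<^esub>\<close> with last vertex in \<open>A\<close> (\<open>rich_extend\<close>), a contradiction.

  The approximate statement for \<open>q + 1\<close> follows by counting. For the exact one, a red \<open>K\<^sub>q\<close>
  in \<open>W\<close> that does not extend into \<open>S\<close> colours \<open>S\<close> with \<open>q\<close> colours such that no pair of \<open>F\<close> is
  monochromatic (\<open>clique_colours_blocked_pairs\<close>). So \<open>F\<close> omits a positive proportion of the pairs,
  \<open>W\<close> gains a multiple of \<open>n\<^sup>2\<close> vertices, and this is what the approximate statement needs.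
\<close>

section \<open>Hall's marriage theorem\<close>

text \<open>If some proper nonempty \<open>J\<close> is critical, it is matched inside its neighbourhood \<open>U\<close> and the rest
  is matched outside \<open>U\<close>. Otherwise every proper nonempty \<open>J\<close> has a spare neighbour, and an arbitrary choice for
  one index can be deleted.\<close>

lemma hall_marriage:
  assumes "finite I" "\<And>i. i \<in> I \<Longrightarrow> finite (A i)"
    and "\<And>J. J \<subseteq> I \<Longrightarrow> card J \<le> card (\<Union>i\<in>J. A i)"
  shows "\<exists>f. inj_on f I \<and> (\<forall>i\<in>I. f i \<in> A i)"
  using assms
proof (induction "card I" arbitrary: I A rule: less_induct)
  case less
  note fin = less.prems(1,2) and hall = less.prems(3)
  have finU: "finite (\<Union>i\<in>J. A i)" if "J \<subseteq> I" for J
    using that fin finite_subset[of J I] by auto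
  show ?case
  proof (cases "I = {}")
    case True
    then show ?thesis by simp
  next
    case False
    show ?thesis
    proof (cases "\<exists>J. J \<subset> I \<and> J \<noteq> {} \<and> card (\<Union>i\<in>J. A i) \<le> card J")
      case True
      then obtain J where J: "J \<subset> I" "J \<noteq> {}" "card (\<Union>i\<in>J. A i) \<le> card J"
        by blast
      define U where "U = (\<Union>i\<in>J. A i)"
      have finJ: "finite J" using J(1) fin(1) finite_subset by blast
      have "\<exists>f. inj_on f J \<and> (\<forall>i\<in>J. f i \<in> A i)"
      proof (rule less.hyps)
        show "card J < card I" using psubset_card_mono[OF fin(1) J(1)] .
        show "finite J" by (rule finJ)
        show "finite (A i)" if "i \<in> J" for i using fin that J(1) by auto
        show "card K \<le> card (\<Union>i\<in>K. A i)" if "K \<subseteq> J" for K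
          using hall[of K] that J(1) by auto
      qed
      then obtain f where f: "inj_on f J" "\<forall>i\<in>J. f i \<in> A i" by blast
      have "\<exists>g. inj_on g (I - J) \<and> (\<forall>i\<in>I - J. g i \<in> A i - U)"
      proof (rule less.hyps)
        show "card (I - J) < card I"
          using J(1,2) fin(1) by (intro psubset_card_mono) auto
        show "finite (I - J)" using fin by simp
        show "finite (A i - U)" if "i \<in> I - J" for i using fin that by simp
        fix K assume K: "K \<subseteq> I - J"
        have finK: "finite K" using K fin(1) finite_subset by blast
        have "card K + card J = card (K \<union> J)"
          using K finK finJ by (subst card_Un_disjoint) auto
        also have "\<dots> \<le> card (\<Union>i\<in>K \<union> J. A i)"
          using hall[of "K \<union> J"] K J(1) by auto
        also have "(\<Union>i\<in>K \<union> J. A i) = (\<Union>i\<in>K. A i - U) \<union> U"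
          unfolding U_def by blast
        also have "card \<dots> \<le> card (\<Union>i\<in>K. A i - U) + card U"
          by (rule card_Un_le)
        finally show "card K \<le> card (\<Union>i\<in>K. A i - U)"
          using J(3) unfolding U_def by linarith
      qed
      then obtain g where g: "inj_on g (I - J)" "\<forall>i\<in>I - J. g i \<in> A i - U" by blast
      have fU: "f i \<in> U" if "i \<in> J" for i using f(2) that unfolding U_def by blast
      have "inj_on (\<lambda>i. if i \<in> J then f i else g i) I"
        using f g fU unfolding inj_on_def by (smt (verit) DiffD2 DiffI)
      moreover have "\<forall>i\<in>I. (if i \<in> J then f i else g i) \<in> A i"
        using f g by auto
      ultimately show ?thesis by blast
    next
      case nocrit: False
      obtain i where i: "i \<in> I" using False by blast
      have "card (A i) \<ge> 1" using hall[of "{i}"] i by simp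
      then obtain x where x: "x \<in> A i" by (metis card.empty ex_in_conv not_one_le_zero)
      have "\<exists>g. inj_on g (I - {i}) \<and> (\<forall>j\<in>I - {i}. g j \<in> A j - {x})"
      proof (rule less.hyps)
        show "card (I - {i}) < card I" using i fin(1) by (meson card_Diff1_less)
        show "finite (I - {i})" using fin by simp
        show "finite (A j - {x})" if "j \<in> I - {i}" for j using fin that by simp
        fix K assume K: "K \<subseteq> I - {i}"
        show "card K \<le> card (\<Union>j\<in>K. A j - {x})"
        proof (cases "K = {}")
          case False
          have "K \<subset> I" using K i by blast
          then have "\<not> card (\<Union>j\<in>K. A j) \<le> card K"
            using nocrit False by blast
          then have "card K < card (\<Union>j\<in>K. A j)" by simp
          also have "(\<Union>j\<in>K. A j) \<subseteq> insert x (\<Union>j\<in>K. A j - {x})" by blast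
          then have "card (\<Union>j\<in>K. A j) \<le> card (insert x (\<Union>j\<in>K. A j - {x}))"
            using finU[of K] \<open>K \<subset> I\<close> by (intro card_mono) (auto intro: finite_subset)
          also have "\<dots> \<le> Suc (card (\<Union>j\<in>K. A j - {x}))" by (rule card_insert_le_m1) auto
          finally show ?thesis by simp
        qed simp
      qed
      then obtain g where g: "inj_on g (I - {i})" "\<forall>j\<in>I - {i}. g j \<in> A j - {x}" by blast
      have "inj_on (g(i := x)) I"
        using g unfolding inj_on_def by auto
      moreover have "\<forall>j\<in>I. (g(i := x)) j \<in> A j" using g x by auto
      ultimately show ?thesis by blast
    qed
  qed
qed

section \<open>Abundance of red cliques\<close>

text \<open>A recursive form of ``many red \<open>K\<^sub>q\<close>'': there are at least \<open>t\<close> choices for the first vertex, for each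
  of them at least \<open>t\<close> choices of a second one in its red neighbourhood, and so on. Unlike a bound on
  the number of cliques, it survives deletion of exceptional vertices at every level.\<close>

fun rich :: "('a \<Rightarrow> 'a \<Rightarrow> bool) \<Rightarrow> real \<Rightarrow> nat \<Rightarrow> 'a set \<Rightarrow> bool" where
  "rich R t 0 W \<longleftrightarrow> True"
| "rich R t (Suc q) W \<longleftrightarrow> t \<le> card {w \<in> W. rich R t q {x \<in> W. R w x}}"

lemma rich_imp_clique:
  assumes "rich R t q W" "t > 0" "finite W" "symp R" "irreflp R"
  shows "\<exists>Q\<subseteq>W. card Q = q \<and> (\<forall>x\<in>Q. \<forall>y\<in>Q. x \<noteq> y \<longrightarrow> R x y)"
  using assms(1,3)
proof (induction q arbitrary: W)
  case 0
  then show ?case by (intro exI[of _ "{}"]) simp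
next
  case (Suc q)
  have "card {w \<in> W. rich R t q {x \<in> W. R w x}} \<noteq> 0"
    using Suc.prems(1) assms(2) by auto
  then obtain w where w: "w \<in> W" "rich R t q {x \<in> W. R w x}"
    by (metis (mono_tags, lifting) card.empty empty_Collect_eq)
  obtain Q where Q: "Q \<subseteq> {x \<in> W. R w x}" "card Q = q"
      "\<forall>x\<in>Q. \<forall>y\<in>Q. x \<noteq> y \<longrightarrow> R x y"
    using Suc.IH[OF w(2)] Suc.prems(2) by auto
  have "finite Q" using Q(1) Suc.prems(2) by (auto intro: finite_subset)
  moreover have "w \<notin> Q" using Q(1) assms(5) by (auto dest: irreflpD)
  ultimately have "card (insert w Q) = Suc q" using Q(2) by simp
  moreover have "\<forall>x\<in>insert w Q. \<forall>y\<in>insert w Q. x \<noteq> y \<longrightarrow> R x y"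
    using Q(1,3) assms(4) by (auto dest: sympD)
  ultimately show ?case using Q(1) w(1) by (intro exI[of _ "insert w Q"]) auto
qed

text \<open>Since \<open>t' < t\<close>, some first vertex is good for \<open>t\<close> and bad for \<open>t'\<close>; iterating inside red
  neighbourhoods leaves the common red neighbourhood \<open>Z\<close> of a clique, where the two conditions have
  become statements about the size and the red degrees of \<open>Z\<close>.\<close>

lemma rich_sparse_subset:
  fixes t t' :: real
  assumes "rich R t (Suc j) W" "\<not> rich R t' (Suc (Suc j)) W" "t' < t" "finite W"
  shows "\<exists>Z\<subseteq>W. t \<le> card Z \<and> card {z \<in> Z. t' \<le> card {x \<in> Z. R z x}} < t'"
  using assms
proof (induction j arbitrary: W)
  case 0
  then show ?case by (intro exI[of _ W]) auto
next
  case (Suc j)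
  let ?G = "{w \<in> W. rich R t (Suc j) {x \<in> W. R w x}}"
  let ?B = "{w \<in> W. rich R t' (Suc (Suc j)) {x \<in> W. R w x}}"
  have "card ?B < card ?G"
    using Suc.prems(1-3) unfolding rich.simps(2)[of R t "Suc j"] rich.simps(2)[of R t' "Suc (Suc j)"]
    by linarith
  then have "\<not> ?G \<subseteq> ?B"
    using card_mono[of ?B ?G] Suc.prems(4) by auto
  then obtain w where w: "w \<in> W" "rich R t (Suc j) {x \<in> W. R w x}"
      "\<not> rich R t' (Suc (Suc j)) {x \<in> W. R w x}"
    by blast
  show ?case
    using Suc.IH[OF w(2,3) Suc.prems(3)] Suc.prems(4) by auto
qed

text \<open>The last vertex is taken from \<open>X\<close>. While the cliques of \<open>U\<close> are enumerated,
  \<open>X\<close> is replaced by a part of its intersection with the red neighbourhood of the vertex just chosen.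
  Its size drops by the factor \<open>l\<close> each time, at the price of at most \<open>u\<close> excluded vertices. The sizes
  are prescribed exactly because regularity is available for multiples of a fixed block size only.\<close>

lemma rich_extend:
  fixes t t' u :: real
  assumes "finite Y" "U \<subseteq> Y" "X \<subseteq> Y" "U \<subseteq> P" "X \<subseteq> A"
    and "rich R t j U" "j \<le> q" "card X = l ^ j * s"
    and few: "\<And>i X. i < q \<Longrightarrow> X \<subseteq> A \<Longrightarrow> card X = l ^ Suc i * s \<Longrightarrow>
      card {w \<in> P. card {x \<in> X. R w x} < l ^ i * s} \<le> u"
    and "finite P" "t' + u \<le> t" "t' \<le> s"
  shows "rich R t' (Suc j) Y"
  using assms(1-8)
proof (induction j arbitrary: X Y U)
  case 0
  have "card X \<le> card Y" using 0 by (auto intro: card_mono)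
  then have "t' \<le> real (card Y)" using assms(12) 0 by simp
  then show ?case by simp
next
  case (Suc j)
  let ?G = "{w \<in> U. rich R t j {x \<in> U. R w x}}"
  let ?B = "{w \<in> P. card {x \<in> X. R w x} < l ^ j * s}"
  have finU: "finite U" using Suc.prems(1,2) finite_subset by blast
  have "card ?B \<le> u" using few[of j X] Suc.prems by auto
  moreover have "t \<le> card ?G" using Suc.prems(6) by simp
  moreover have "card ?G \<le> card (?G - ?B) + card ?B"
  proof -
    have "card ?G \<le> card ((?G - ?B) \<union> ?B)"
      using finU assms(10) by (intro card_mono) auto
    then show ?thesis using card_Un_le[of "?G - ?B" ?B] by linarith
  qed
  ultimately have "t' \<le> card (?G - ?B)"
    using assms(11) by linarith
  also have "card (?G - ?B) \<le> card {w \<in> Y. rich R t' (Suc j) {x \<in> Y. R w x}}"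
  proof (intro of_nat_mono card_mono subsetI)
    show "finite {w \<in> Y. rich R t' (Suc j) {x \<in> Y. R w x}}" using Suc.prems(1) by simp
    fix w assume w: "w \<in> ?G - ?B"
    then have "l ^ j * s \<le> card {x \<in> X. R w x}" using Suc.prems(4) by auto
    then obtain X' where X': "X' \<subseteq> {x \<in> X. R w x}" "card X' = l ^ j * s"
      by (meson obtain_subset_with_card_n)
    have "rich R t' (Suc j) {x \<in> Y. R w x}"
      by (rule Suc.IH[where U = "{x \<in> U. R w x}" and X = X'])
        (use w X' Suc.prems in auto)
    then show "w \<in> {w \<in> Y. rich R t' (Suc j) {x \<in> Y. R w x}}"
      using w Suc.prems(2) by blast
  qed
  finally show ?case by simp
qed

section \<open>Densities, energy and sampling\<close>

definition nbr_density :: "('a \<Rightarrow> 'a \<Rightarrow> bool) \<Rightarrow> 'a \<Rightarrow> 'a set \<Rightarrow> real" where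
  "nbr_density R w X = real (card {x \<in> X. R w x}) / real (card X)"

text \<open>The mean square density of the energy increment method, left unnormalised.\<close>

definition energy :: "('a \<Rightarrow> 'a \<Rightarrow> bool) \<Rightarrow> 'a set \<Rightarrow> 'a set \<Rightarrow> real" where
  "energy R V X = (\<Sum>w\<in>V. (nbr_density R w X)\<^sup>2)"

lemma nbr_density_bounds:
  assumes "finite X"
  shows "0 \<le> nbr_density R w X" "nbr_density R w X \<le> 1"
proof -
  have "card {x \<in> X. R w x} \<le> card X" using assms by (auto intro: card_mono)
  then show "0 \<le> nbr_density R w X" "nbr_density R w X \<le> 1"
    unfolding nbr_density_def by (auto simp: divide_le_eq_1)
qed

lemma card_mult_nbr_density:
  assumes "finite X"
  shows "real (card X) * nbr_density R w X = real (card {x \<in> X. R w x})"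
  using assms by (cases "X = {}") (auto simp: nbr_density_def)

lemma energy_bounds:
  assumes "finite X"
  shows "0 \<le> energy R V X" "energy R V X \<le> card V"
proof -
  have "energy R V X \<le> (\<Sum>w\<in>V. 1)"
    unfolding energy_def
    by (intro sum_mono) (simp add: nbr_density_bounds[OF assms] power_le_one)
  then show "energy R V X \<le> card V" by simp
qed (simp add: energy_def sum_nonneg)

text \<open>Convexity with its defect: the density in \<open>A\<close> is the weighted mean of the densities in \<open>X\<close> and
  in \<open>A - X\<close>, so splitting \<open>A\<close> gains the variance, of which the part of \<open>X\<close> is kept.\<close>

lemma energy_split:
  assumes "finite A" "X \<subseteq> A"
  shows "card X * (\<Sum>w\<in>V. (nbr_density R w X - nbr_density R w A)\<^sup>2)
    \<le> card X * energy R V X + card (A - X) * energy R V (A - X) - card A * energy R V A"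
proof -
  have finX: "finite X" using assms finite_subset by blast
  have "card X * (nbr_density R w X - nbr_density R w A)\<^sup>2
      \<le> card X * (nbr_density R w X)\<^sup>2 + card (A - X) * (nbr_density R w (A - X))\<^sup>2
        - card A * (nbr_density R w A)\<^sup>2" for w
  proof -
    define x y u v m where "x = real (card X)" and "y = real (card (A - X))"
      and "u = nbr_density R w X" and "v = nbr_density R w (A - X)" and "m = nbr_density R w A"
    have cA: "real (card A) = x + y"
      using assms finX unfolding x_def y_def
      by (metis card_Diff_subset card_mono le_add_diff_inverse of_nat_add)
    have "{a \<in> A. R w a} = {a \<in> X. R w a} \<union> {a \<in> A - X. R w a}" using assms(2) by blast
    then have "card {a \<in> A. R w a} = card {a \<in> X. R w a} + card {a \<in> A - X. R w a}"
      using assms(1) finX by (simp only:) (subst card_Un_disjoint, auto)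
    then have "x * u + y * v = (x + y) * m"
      using card_mult_nbr_density[of X R w] card_mult_nbr_density[of "A - X" R w]
        card_mult_nbr_density[of A R w] assms(1) finX cA
      unfolding x_def y_def u_def v_def m_def by simp
    then have "x * (u - m)\<^sup>2 + y * (v - m)\<^sup>2 = x * u\<^sup>2 + y * v\<^sup>2 - (x + y) * m\<^sup>2"
      by algebra
    moreover have "0 \<le> y * (v - m)\<^sup>2" unfolding y_def by simp
    ultimately show ?thesis
      unfolding cA unfolding x_def y_def u_def v_def m_def by linarith
  qed
  then have "(\<Sum>w\<in>V. card X * (nbr_density R w X - nbr_density R w A)\<^sup>2)
      \<le> (\<Sum>w\<in>V. card X * (nbr_density R w X)\<^sup>2 + card (A - X) * (nbr_density R w (A - X))\<^sup>2
        - card A * (nbr_density R w A)\<^sup>2)"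
    by (intro sum_mono)
  then show ?thesis
    by (simp add: energy_def sum_distrib_left sum.distrib sum_subtractf)
qed

text \<open>The energy of a disjoint union is at most a weighted mean, so no union of blocks beats the best block.\<close>

lemma energy_le_multiple:
  assumes bound: "\<And>X. X \<subseteq> A \<Longrightarrow> card X = b \<Longrightarrow> energy R V X \<le> M"
    and "finite A" "b > 0" "j > 0" "X \<subseteq> A" "card X = j * b"
  shows "energy R V X \<le> M"
  using assms(4-6)
proof (induction j arbitrary: X)
  case 0
  then show ?case by simp
next
  case (Suc j)
  show ?case
  proof (cases "j = 0")
    case True
    then show ?thesis using Suc.prems bound by simp
  next
    case False
    have finX: "finite X" using Suc.prems(2) assms(2) finite_subset by blast
    obtain Y where Y: "Y \<subseteq> X" "card Y = b"
      using Suc.prems(3) obtain_subset_with_card_n[of b X] by auto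
    have c: "card (X - Y) = j * b"
      using Y finX Suc.prems(3) finite_subset[of Y X] by (simp add: card_Diff_subset)
    have "energy R V (X - Y) \<le> M"
      using Suc.IH[of "X - Y"] False Suc.prems(2) c by blast
    moreover have "energy R V Y \<le> M" using bound[of Y] Y Suc.prems(2) by blast
    ultimately have "real b * energy R V Y + real (j * b) * energy R V (X - Y)
        \<le> real b * M + real (j * b) * M"
      by (intro add_mono mult_left_mono) auto
    moreover have "0 \<le> real (card Y) * (\<Sum>w\<in>V. (nbr_density R w Y - nbr_density R w X)\<^sup>2)"
      by (simp add: sum_nonneg)
    ultimately have "real (Suc j * b) * energy R V X \<le> real (Suc j * b) * M"
      using energy_split[OF finX Y(1), of R V] c Y(2) Suc.prems(3) by (simp add: algebra_simps)
    moreover have "0 < real (Suc j * b)" using \<open>b > 0\<close> by (simp only: of_nat_0_less_iff) simp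
    ultimately show ?thesis by (simp only: mult_le_cancel_left_pos)
  qed
qed

text \<open>Let \<open>f k\<close> be the largest energy of a subset of size \<open>s * L ^ k\<close>. It decreases from at most \<open>|V|\<close>
  to at least \<open>0\<close>, so one of the \<open>T\<close> steps is at most \<open>|V| / T\<close>. A set \<open>A\<close> attaining \<open>f (k + 1)\<close> at such
  a step has no part of much larger energy, and by convexity the densities in its parts
  cannot deviate much from those in \<open>A\<close>.\<close>

lemma regular_subset:
  assumes "finite V" "finite A0" "L > 0" "T > 0" "s > 0" "s * L ^ T \<le> card A0"
  shows "\<exists>A k. A \<subseteq> A0 \<and> card A = L * (s * L ^ k) \<and>
    (\<forall>X\<subseteq>A. X \<noteq> {} \<and> s * L ^ k dvd card X \<longrightarrow>
      (\<Sum>w\<in>V. (nbr_density R w X - nbr_density R w A)\<^sup>2) \<le> L * card V / T)"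
proof -
  define D where "D k = {X. X \<subseteq> A0 \<and> card X = s * L ^ k}" for k
  define f where "f k = Max (energy R V ` D k)" for k
  have finD: "finite (D k)" for k
    unfolding D_def using assms(2) by (auto intro: finite_subset[of _ "Pow A0"])
  have neD: "D k \<noteq> {}" if "k \<le> T" for k
  proof -
    have "s * L ^ k \<le> s * L ^ T" using that assms(3) by (simp add: power_increasing)
    then have "s * L ^ k \<le> card A0" using assms(6) by linarith
    then show ?thesis
      unfolding D_def using obtain_subset_with_card_n[of "s * L ^ k" A0] by blast
  qed
  have f_ge: "energy R V X \<le> f k" if "X \<in> D k" for X k
    unfolding f_def using that finD by simp
  have f_in: "\<exists>X\<in>D k. energy R V X = f k" if "k \<le> T" for k
    using Max_in[of "energy R V ` D k"] finD neD[OF that] unfolding f_def by fastforce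
  have finX: "finite X" if "X \<in> D k" for X k
    using that assms(2) finite_subset unfolding D_def by blast
  have "f 0 \<le> card V" "0 \<le> f T"
    using f_in[of 0] f_in[of T] energy_bounds finX by (metis le0, metis order_refl)
  have "\<exists>k<T. f k - f (Suc k) \<le> card V / T"
  proof (rule ccontr)
    assume "\<not> ?thesis"
    then have "(\<Sum>k<T. card V / T) < (\<Sum>k<T. f k - f (Suc k))"
      using assms(4) by (intro sum_strict_mono) auto
    also have "\<dots> = f 0 - f T" by (rule sum_lessThan_telescope')
    finally show False
      using \<open>f 0 \<le> card V\<close> \<open>0 \<le> f T\<close> assms(4) by simp
  qed
  then obtain k where k: "k < T" "f k - f (Suc k) \<le> card V / T" by blast
  obtain A where A: "A \<in> D (Suc k)" "energy R V A = f (Suc k)" using f_in[of "Suc k"] k(1) by auto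
  let ?b = "s * L ^ k"
  have b: "?b > 0" using assms(3,5) by simp
  have AA: "A \<subseteq> A0" "card A = L * ?b" using A(1) unfolding D_def by auto
  have finA: "finite A" using AA(1) assms(2) finite_subset by blast
  have le_f: "energy R V X \<le> f k" if "X \<subseteq> A" "card X = j * ?b" "j > 0" for X j
    using energy_le_multiple[of A ?b R V "f k" j X] f_ge[of _ k] that b finA AA(1)
    unfolding D_def by blast
  have "(\<Sum>w\<in>V. (nbr_density R w X - nbr_density R w A)\<^sup>2) \<le> L * card V / T"
    if X: "X \<subseteq> A" "X \<noteq> {}" "?b dvd card X" for X
  proof -
    have finX': "finite X" using X(1) finA finite_subset by blast
    obtain j where j: "card X = j * ?b" using X(3) by (metis dvdE mult.commute)
    have "j > 0" using j X(2) finX' by (cases j) auto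
    let ?Y = "A - X"
    have cY: "card ?Y = (L - j) * ?b"
      using X(1) finX' AA(2) j by (simp add: card_Diff_subset diff_mult_distrib)
    have cXY: "real (card X) + card ?Y = card A"
      using X(1) finA finX' by (metis card_Diff_subset card_mono le_add_diff_inverse of_nat_add)
    have eX: "energy R V X \<le> f k" using le_f[of X j] X(1) j \<open>j > 0\<close> by blast
    have eY: "card ?Y * energy R V ?Y \<le> card ?Y * f k"
    proof (cases "L - j = 0")
      case True
      then show ?thesis using cY by simp
    next
      case False
      then show ?thesis using le_f[of ?Y "L - j"] cY by (intro mult_left_mono) auto
    qed
    define \<Delta> where "\<Delta> = (\<Sum>w\<in>V. (nbr_density R w X - nbr_density R w A)\<^sup>2)"
    have "card X * \<Delta> \<le> card X * f k + card ?Y * f k - card A * f (Suc k)"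
      using energy_split[OF finA X(1), of R V, unfolded A(2)] eY
        mult_left_mono[OF eX of_nat_0_le_iff[of "card X"]]
      unfolding \<Delta>_def by linarith
    also have "\<dots> = card A * (f k - f (Suc k))" using cXY by (metis distrib_right right_diff_distrib)
    also have "\<dots> \<le> card A * (card V / T)" using k(2) by (intro mult_left_mono) auto
    finally have 1: "j * ?b * \<Delta> \<le> L * ?b * (card V / T)" using j AA(2) by simp
    \<comment> \<open>The weight of \<open>X\<close> is at least that of one block, hence at least the fraction \<open>1 / L\<close> of \<open>A\<close>.\<close>
    have "?b * \<Delta> \<le> j * ?b * \<Delta>"
    proof -
      have "?b \<le> j * ?b" using \<open>j > 0\<close> by simp
      then have "real ?b \<le> real (j * ?b)" by (rule of_nat_mono)
      moreover have "0 \<le> \<Delta>" unfolding \<Delta>_def by (simp add: sum_nonneg)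
      ultimately show ?thesis by (rule mult_right_mono)
    qed
    with 1 have "real ?b * \<Delta> \<le> real ?b * (L * (card V / T))" by (simp add: mult_ac)
    then show ?thesis using b unfolding \<Delta>_def[symmetric] by (simp only: mult_le_cancel_left_pos of_nat_0_less_iff) simp
  qed
  then show ?thesis using AA by blast
qed

text \<open>A derandomised second moment argument: \<open>A\<close> is cut into \<open>n\<close> groups of size \<open>g\<close> and one vertex is
  picked from each. For a random pick the cross terms vanish on average, so some pick
  increases the total squared error by at most \<open>|V|\<close>.\<close>

lemma sample_subset:
  assumes "finite V" "finite A" "card A = n * g" "g > 0"
  shows "\<exists>S\<subseteq>A. card S = n \<and>
    (\<Sum>w\<in>V. (real (card {x \<in> S. R w x}) - card {x \<in> A. R w x} / g)\<^sup>2) \<le> n * card V"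
  using assms(2,3)
proof (induction n arbitrary: A)
  case 0
  then show ?case by (intro exI[of _ "{}"]) auto
next
  case (Suc n)
  obtain A' where A': "A' \<subseteq> A" "card A' = n * g"
    using Suc.prems obtain_subset_with_card_n[of "n * g" A] by auto
  have finA': "finite A'" using A'(1) Suc.prems(1) finite_subset by blast
  define G where "G = A - A'"
  have finG: "finite G" unfolding G_def using Suc.prems(1) by simp
  have cG: "card G = g"
    unfolding G_def using A' finA' Suc.prems(2) by (simp add: card_Diff_subset)
  obtain S' where S': "S' \<subseteq> A'" "card S' = n"
      "(\<Sum>w\<in>V. (real (card {x \<in> S'. R w x}) - card {x \<in> A'. R w x} / g)\<^sup>2) \<le> n * card V"
    using Suc.IH[OF finA' A'(2)] by blast
  have finS': "finite S'" using S'(1) finA' finite_subset by blast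
  define P where "P w = real (card {x \<in> S'. R w x}) - card {x \<in> A'. R w x} / g" for w
  define b where "b w s = (if R w s then 1 else 0 :: real)" for w s
  define \<mu> where "\<mu> w = card {x \<in> G. R w x} / g" for w
  have sum_b: "(\<Sum>s\<in>G. b w s) = g * \<mu> w" for w
    unfolding b_def \<mu>_def using finG assms(4) by (simp add: sum.If_cases Int_def conj_commute)
  have \<mu>: "0 \<le> \<mu> w" "\<mu> w \<le> 1" for w
  proof -
    have "card {x \<in> G. R w x} \<le> g" using finG cG card_mono[of G "{x \<in> G. R w x}"] by auto
    then show "0 \<le> \<mu> w" "\<mu> w \<le> 1" unfolding \<mu>_def using assms(4) by auto
  qed
  have one: "(\<Sum>s\<in>G. (P w + (b w s - \<mu> w))\<^sup>2) \<le> g * ((P w)\<^sup>2 + 1)" for w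
  proof -
    have "(\<Sum>s\<in>G. (P w + (b w s - \<mu> w))\<^sup>2)
        = (\<Sum>s\<in>G. (P w)\<^sup>2 + 2 * P w * (b w s - \<mu> w) + (b w s - \<mu> w)\<^sup>2)"
      by (intro sum.cong refl) (simp only: power2_sum add_ac mult_ac)
    also have "\<dots> = g * (P w)\<^sup>2 + 2 * P w * (\<Sum>s\<in>G. b w s - \<mu> w) + (\<Sum>s\<in>G. (b w s - \<mu> w)\<^sup>2)"
      by (simp only: sum.distrib sum_distrib_left[symmetric] sum_constant cG)
    also have "(\<Sum>s\<in>G. b w s - \<mu> w) = 0" by (simp add: sum_subtractf sum_b cG)
    also have "(\<Sum>s\<in>G. (b w s - \<mu> w)\<^sup>2) \<le> (\<Sum>s\<in>G. 1)"
    proof (intro sum_mono)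
      fix s
      have "\<bar>b w s - \<mu> w\<bar> \<le> 1" using \<mu>[of w] unfolding b_def by auto
      then show "(b w s - \<mu> w)\<^sup>2 \<le> 1" by (simp add: abs_square_le_1)
    qed
    finally show ?thesis by (simp add: cG algebra_simps)
  qed
  have "\<exists>s\<in>G. (\<Sum>w\<in>V. (P w + (b w s - \<mu> w))\<^sup>2) \<le> Suc n * card V"
  proof (rule ccontr)
    assume "\<not> ?thesis"
    then have "(\<Sum>s\<in>G. real (Suc n * card V)) < (\<Sum>s\<in>G. \<Sum>w\<in>V. (P w + (b w s - \<mu> w))\<^sup>2)"
      using finG cG assms(4) by (intro sum_strict_mono) auto
    also have "\<dots> = (\<Sum>w\<in>V. \<Sum>s\<in>G. (P w + (b w s - \<mu> w))\<^sup>2)" by (rule sum.swap)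
    also have "\<dots> \<le> (\<Sum>w\<in>V. g * ((P w)\<^sup>2 + 1))" by (intro sum_mono one)
    also have "\<dots> = g * ((\<Sum>w\<in>V. (P w)\<^sup>2) + card V)"
      by (simp add: sum_distrib_left[symmetric] sum.distrib)
    also have "\<dots> \<le> real g * (real (n * card V) + card V)"
      using S'(3) unfolding P_def by (intro mult_left_mono add_right_mono) auto
    finally show False using cG by (simp add: algebra_simps)
  qed
  then obtain s where s: "s \<in> G" "(\<Sum>w\<in>V. (P w + (b w s - \<mu> w))\<^sup>2) \<le> Suc n * card V" by blast
  have sS': "s \<notin> S'" using s(1) S'(1) unfolding G_def by blast
  have "P w + (b w s - \<mu> w)
      = real (card {x \<in> insert s S'. R w x}) - card {x \<in> A. R w x} / g" for w
  proof -
    have "{x \<in> insert s S'. R w x} = (if R w s then insert s {x \<in> S'. R w x} else {x \<in> S'. R w x})"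
      by auto
    then have "real (card {x \<in> insert s S'. R w x}) = card {x \<in> S'. R w x} + b w s"
      using finS' sS' unfolding b_def by auto
    moreover have "{x \<in> A. R w x} = {x \<in> A'. R w x} \<union> {x \<in> G. R w x}"
      unfolding G_def using A'(1) by blast
    then have "card {x \<in> A. R w x} = card {x \<in> A'. R w x} + card {x \<in> G. R w x}"
      using finA' finG unfolding G_def by (simp only:) (subst card_Un_disjoint, auto)
    ultimately show ?thesis unfolding P_def \<mu>_def by (simp add: add_divide_distrib)
  qed
  then have "(\<Sum>w\<in>V. (real (card {x \<in> insert s S'. R w x}) - card {x \<in> A. R w x} / g)\<^sup>2)
      \<le> Suc n * card V"
    using s(2) by simp
  moreover have "insert s S' \<subseteq> A" using s(1) S'(1) A'(1) unfolding G_def by blast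
  moreover have "card (insert s S') = Suc n" using sS' finS' S'(2) by simp
  ultimately show ?case by blast
qed

text \<open>Chebyshev's inequality.\<close>

lemma card_large_deviation:
  fixes f :: "'a \<Rightarrow> real"
  assumes "finite V" "(\<Sum>w\<in>V. (f w)\<^sup>2) \<le> B" "e > 0"
  shows "real (card {w \<in> V. e \<le> \<bar>f w\<bar>}) \<le> B / e\<^sup>2"
proof -
  have "e\<^sup>2 * card {w \<in> V. e \<le> \<bar>f w\<bar>} = (\<Sum>w\<in>{w \<in> V. e \<le> \<bar>f w\<bar>}. e\<^sup>2)" by simp
  also have "\<dots> \<le> (\<Sum>w\<in>{w \<in> V. e \<le> \<bar>f w\<bar>}. (f w)\<^sup>2)"
    using assms(3) by (intro sum_mono) (metis (mono_tags) abs_le_square_iff abs_of_pos mem_Collect_eq)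
  also have "\<dots> \<le> (\<Sum>w\<in>V. (f w)\<^sup>2)" using assms(1) by (intro sum_mono2) auto
  finally show ?thesis using assms by (simp add: field_simps)
qed

section \<open>Branch sets and their blocked vertices\<close>

text \<open>\<open>S\<close> holds the branch vertices and \<open>\<phi>\<close> the subdividing ones. As \<open>\<phi> e\<close> lies outside \<open>S\<close>, not being
  red to the ends of \<open>e\<close> means being blue to them.\<close>

definition blue_subdiv :: "('a \<Rightarrow> 'a \<Rightarrow> bool) \<Rightarrow> nat \<Rightarrow> 'a set \<Rightarrow> bool" where
  "blue_subdiv R n V \<longleftrightarrow> (\<exists>S \<phi>. S \<subseteq> V \<and> card S = n \<and> inj_on \<phi> ([S]\<^bsup>2\<^esup>) \<and>
     (\<forall>e\<in>[S]\<^bsup>2\<^esup>. \<phi> e \<in> V - S \<and> (\<forall>a\<in>e. \<not> R a (\<phi> e))))"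

lemma blue_subdiv_mono: "blue_subdiv R n U \<Longrightarrow> U \<subseteq> V \<Longrightarrow> blue_subdiv R n V"
  unfolding blue_subdiv_def by (elim exE conjE, intro exI conjI) auto

text \<open>\<open>F\<close> is a set of pairs that violates Hall's condition and \<open>W\<close> consists of all vertices outside \<open>S\<close>
  that could subdivide no pair of \<open>F\<close>.\<close>

lemma hall_violator:
  assumes "finite V" "S \<subseteq> V" "card S = n" "\<not> blue_subdiv R n V"
  shows "\<exists>F W. F \<subseteq> [S]\<^bsup>2\<^esup> \<and> W \<subseteq> V - S \<and> card V < card W + card F + n \<and>
    (\<forall>w\<in>W. \<forall>e\<in>F. \<exists>a\<in>e. R a w)"
proof -
  define A where "A e = {w \<in> V - S. \<forall>a\<in>e. \<not> R a w}" for e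
  have finS: "finite S" using assms(1,2) finite_subset by blast
  have "\<not> (\<exists>\<phi>. inj_on \<phi> ([S]\<^bsup>2\<^esup>) \<and> (\<forall>e\<in>[S]\<^bsup>2\<^esup>. \<phi> e \<in> A e))"
    using assms(2-4) unfolding blue_subdiv_def A_def by blast
  moreover have "finite ([S]\<^bsup>2\<^esup>)" using finS by (simp add: finite_imp_finite_nsets)
  moreover have "finite (A e)" for e unfolding A_def using assms(1) by simp
  ultimately obtain F where F: "F \<subseteq> [S]\<^bsup>2\<^esup>" "card (\<Union>e\<in>F. A e) < card F"
    using hall_marriage[of "[S]\<^bsup>2\<^esup>" A] by (meson not_le_imp_less)
  define W where "W = V - S - (\<Union>e\<in>F. A e)"
  have U: "(\<Union>e\<in>F. A e) \<subseteq> V - S" unfolding A_def by blast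
  have "card V = n + card (V - S)"
    using assms finS by (metis card_Diff_subset card_mono le_add_diff_inverse)
  also have "card (V - S) = card (\<Union>e\<in>F. A e) + card W"
    unfolding W_def using U assms(1)
    by (metis card_Diff_subset card_mono finite_Diff finite_subset le_add_diff_inverse)
  finally have "card V < card W + card F + n" using F(2) by linarith
  moreover have "\<forall>w\<in>W. \<forall>e\<in>F. \<exists>a\<in>e. R a w" unfolding W_def A_def by blast
  moreover have "W \<subseteq> V - S" unfolding W_def by blast
  ultimately show ?thesis using F(1) by blast
qed

text \<open>The constant \<open>C\<close> is there because regularity loses a proportion of \<open>|V|\<close>,
  and this must be small compared to \<open>n\<^sup>2\<close>.\<close>

definition abundant :: "nat \<Rightarrow> bool" where
  "abundant q \<longleftrightarrow> (\<forall>\<eta>>0. \<forall>C>0. \<exists>\<gamma>>0. \<exists>n0. \<forall>n\<ge>n0. \<forall>(R :: nat \<Rightarrow> nat \<Rightarrow> bool) V.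
     symp R \<longrightarrow> finite V \<longrightarrow> \<not> blue_subdiv R n V \<longrightarrow>
     ((real q - 1) / 2 + \<eta>) * (real n)\<^sup>2 \<le> card V \<longrightarrow> card V \<le> C * (real n)\<^sup>2 \<longrightarrow>
     rich R (\<gamma> * (real n)\<^sup>2) q V)"

lemma abundantE:
  assumes "abundant q" "\<eta> > 0" "C > 0"
  obtains \<gamma> n0 where "\<gamma> > 0" "\<And>n (R :: nat \<Rightarrow> nat \<Rightarrow> bool) V. n \<ge> n0 \<Longrightarrow>
     symp R \<Longrightarrow> finite V \<Longrightarrow> \<not> blue_subdiv R n V \<Longrightarrow>
     ((real q - 1) / 2 + \<eta>) * (real n)\<^sup>2 \<le> card V \<Longrightarrow> card V \<le> C * (real n)\<^sup>2 \<Longrightarrow>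
     rich R (\<gamma> * (real n)\<^sup>2) q V"
proof -
  from assms(1)[unfolded abundant_def, THEN spec, THEN mp, OF assms(2), THEN spec, THEN mp, OF assms(3)]
  obtain \<gamma> n0 where "\<gamma> > 0" and *: "\<forall>n\<ge>n0. \<forall>(R :: nat \<Rightarrow> nat \<Rightarrow> bool) V.
     symp R \<longrightarrow> finite V \<longrightarrow> \<not> blue_subdiv R n V \<longrightarrow>
     ((real q - 1) / 2 + \<eta>) * (real n)\<^sup>2 \<le> card V \<longrightarrow> card V \<le> C * (real n)\<^sup>2 \<longrightarrow>
     rich R (\<gamma> * (real n)\<^sup>2) q V"
    by (elim exE conjE)
  show thesis
    by (rule that[OF \<open>\<gamma> > 0\<close> *[rule_format]])
qed

lemma few_atypical:
  assumes "finite V" "card X = l * b" "b > 0" "l > 0" "2 / \<delta> \<le> l" "\<delta> > 0"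
    and "(\<Sum>w\<in>V. (nbr_density R w X - nbr_density R w A)\<^sup>2) \<le> B"
  shows "real (card {w \<in> {w \<in> V. \<delta> \<le> nbr_density R w A}. card {x \<in> X. R w x} < b}) \<le> B / (\<delta> / 2)\<^sup>2"
proof -
  have "{w \<in> {w \<in> V. \<delta> \<le> nbr_density R w A}. card {x \<in> X. R w x} < b}
      \<subseteq> {w \<in> V. \<delta> / 2 \<le> \<bar>nbr_density R w X - nbr_density R w A\<bar>}"
  proof (intro subsetI CollectI conjI)
    fix w assume w: "w \<in> {w \<in> {w \<in> V. \<delta> \<le> nbr_density R w A}. card {x \<in> X. R w x} < b}"
    then show "w \<in> V" by blast
    have "nbr_density R w X \<le> b / (l * b)"
      unfolding nbr_density_def assms(2) using w by (intro divide_right_mono) auto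
    also have "b / (l * b) = 1 / l" using assms(3) by simp
    also have "\<dots> \<le> \<delta> / 2" using assms(4-6) by (simp add: field_simps)
    finally show "\<delta> / 2 \<le> \<bar>nbr_density R w X - nbr_density R w A\<bar>"
      using w by (simp add: field_simps abs_if)
  qed
  then have "card {w \<in> {w \<in> V. \<delta> \<le> nbr_density R w A}. card {x \<in> X. R w x} < b}
      \<le> card {w \<in> V. \<delta> / 2 \<le> \<bar>nbr_density R w X - nbr_density R w A\<bar>}"
    using assms(1) by (intro card_mono) auto
  also have "real \<dots> \<le> B / (\<delta> / 2)\<^sup>2"
    using assms by (intro card_large_deviation) auto
  finally show ?thesis by simp
qed

lemma card_edges_le_cover:
  assumes "finite S" "F \<subseteq> [S]\<^bsup>2\<^esup>" "\<forall>e\<in>F. \<exists>a\<in>e. a \<in> D" "D \<subseteq> S"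
  shows "card F \<le> card D * card S"
proof -
  have "F \<subseteq> (\<lambda>(a, b). {a, b}) ` (D \<times> S)"
  proof
    fix e assume e: "e \<in> F"
    then obtain x y where xy: "e = {x, y}" "x \<in> S" "y \<in> S" using assms(2) by (meson nsets2_E subsetD)
    then have "x \<in> D \<or> y \<in> D" using assms(3) e by auto
    then show "e \<in> (\<lambda>(a, b). {a, b}) ` (D \<times> S)"
      using xy by (auto simp: image_iff insert_commute)
  qed
  moreover have "finite (D \<times> S)" using assms finite_subset by blast
  ultimately have "card F \<le> card (D \<times> S)" by (meson surj_card_le)
  then show ?thesis by (simp add: card_cartesian_product)
qed

text \<open>The common blue neighbours in \<open>A0\<close> of a single pair of \<open>F\<close> are disjoint from \<open>W\<close>, and \<open>|F|\<close> has
  to make up for them.\<close>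

lemma violator_has_many_pairs:
  fixes d :: real
  assumes "finite V" "A0 \<subseteq> V" "S \<subseteq> A0" "card S = n"
    and sparse: "\<And>a. a \<in> A0 \<Longrightarrow> card {x \<in> A0. R a x} \<le> d"
    and "F \<subseteq> [S]\<^bsup>2\<^esup>" "W \<subseteq> V - S" "card V < card W + card F + n"
    and block: "\<forall>w\<in>W. \<forall>e\<in>F. \<exists>a\<in>e. R a w"
  shows "card A0 - 2 * d - n \<le> card F"
proof -
  have finA0: "finite A0" by (rule finite_subset[OF assms(2,1)])
  have finS: "finite S" by (rule finite_subset[OF assms(3) finA0])
  have finW: "finite W" by (rule finite_subset[OF assms(7)]) (simp add: assms(1))
  have "card W \<le> card (V - S)" using assms(1,7) by (intro card_mono) auto
  also have "\<dots> = card V - n" using assms(2-4) finS by (subst card_Diff_subset) auto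
  finally have "F \<noteq> {}"
    using assms(4,8) card_mono[OF assms(1) subset_trans[OF assms(3,2)]] by (cases "F = {}") auto
  then obtain a b where ab: "{a, b} \<in> F" "a \<in> S" "b \<in> S"
    using assms(6) by (metis ex_in_conv nsets2_E subsetD)
  define K where "K = A0 - {x \<in> A0. R a x} - {x \<in> A0. R b x} - S"
  have "real (card A0) - card {x \<in> A0. R a x} - card {x \<in> A0. R b x} - card S \<le> card K"
  proof -
    have "card A0 \<le> card (K \<union> {x \<in> A0. R a x} \<union> {x \<in> A0. R b x} \<union> S)"
      using finA0 finS unfolding K_def by (intro card_mono) auto
    also have "\<dots> \<le> card K + card {x \<in> A0. R a x} + card {x \<in> A0. R b x} + card S"
      by (meson add_right_mono card_Un_le order_trans)
    finally show ?thesis by linarith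
  qed
  moreover have "card (W \<union> K \<union> S) = card W + card K + n"
  proof -
    have "W \<inter> K = {}" using block ab(1) assms(7) unfolding K_def using assms(2) by fastforce
    moreover have "finite K" unfolding K_def using finA0 by simp
    ultimately show ?thesis
      using assms(4,7) finW finS by (subst card_Un_disjoint) (auto simp: K_def card_Un_disjoint)
  qed
  moreover have "card (W \<union> K \<union> S) \<le> card V"
    using assms unfolding K_def by (intro card_mono) auto
  moreover have "card {x \<in> A0. R a x} \<le> d" "card {x \<in> A0. R b x} \<le> d"
    using sparse ab assms(3) by auto
  ultimately show ?thesis using assms(4,8) by linarith
qed

text \<open>Each vertex of \<open>W\<close> has linear red degree to \<open>S\<close>, because its red neighbours
  in \<open>S\<close> cover the many pairs of \<open>F\<close>. The sampling property turns this into positive red density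
  in the regular set \<open>A\<close>, with only linearly many exceptions. If \<open>W\<close> violated the final
  inequality, its red \<open>K\<^sub>q\<close> would extend into \<open>A\<close>.\<close>

lemma small_blocked_set:
  assumes "abundant q" "q > 0" "\<eta> > 0" "C > 0"
  shows "\<exists>\<gamma>>0. \<exists>n0. \<forall>n\<ge>n0. \<forall>(R :: nat \<Rightarrow> nat \<Rightarrow> bool) V.
     symp R \<longrightarrow> finite V \<longrightarrow> \<not> blue_subdiv R n V \<longrightarrow>
     ((real q - 1) / 2 + \<eta>) * (real n)\<^sup>2 \<le> card V \<longrightarrow> card V \<le> C * (real n)\<^sup>2 \<longrightarrow>
     \<not> rich R (\<gamma> * (real n)\<^sup>2) (Suc q) V \<longrightarrow>
     (\<exists>S F W. S \<subseteq> V \<and> card S = n \<and> F \<subseteq> [S]\<^bsup>2\<^esup> \<and> W \<subseteq> V - S \<and>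
       card V < card W + card F + n \<and> (\<forall>w\<in>W. \<forall>e\<in>F. \<exists>a\<in>e. R a w) \<and>
       card W < ((real q - 1) / 2 + \<eta>) * (real n)\<^sup>2)"
proof (rule abundantE[OF assms(1) half_gt_zero[OF assms(3)] assms(4)])
  fix \<gamma> :: real and n1
  assume \<gamma>: "\<gamma> > 0" and ab: "\<And>n (R :: nat \<Rightarrow> nat \<Rightarrow> bool) V. n \<ge> n1 \<Longrightarrow>
     symp R \<Longrightarrow> finite V \<Longrightarrow> \<not> blue_subdiv R n V \<Longrightarrow>
     ((real q - 1) / 2 + \<eta> / 2) * (real n)\<^sup>2 \<le> card V \<Longrightarrow> card V \<le> C * (real n)\<^sup>2 \<Longrightarrow>
     rich R (\<gamma> * (real n)\<^sup>2) q V"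
  \<comment> \<open>\<open>2 * \<delta>\<close> bounds from below the red density to \<open>S\<close> of a vertex of \<open>W\<close>; one extension step shrinks
    the candidate set by \<open>l\<close>, all of them by \<open>L\<close>; \<open>T\<close> makes the exceptional sets
    at most \<open>\<gamma> / 2 * n\<^sup>2\<close>; \<open>c\<close> leaves room for \<open>T\<close> energy increments, each of which shrinks the set by \<open>L\<close>.\<close>
  define \<delta> where "\<delta> = \<gamma> / 4"
  define l where "l = nat \<lceil>2 / \<delta>\<rceil>"
  define L where "L = l ^ q"
  define T where "T = nat \<lceil>2 * L * C / (\<gamma> * (\<delta> / 2)\<^sup>2)\<rceil> + 1"
  define c where "c = \<gamma> / (2 * real (L ^ T))"
  define \<gamma>' where "\<gamma>' = min (\<gamma> / 10) (c / 2)"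
  define n0 where "n0 = Max {n1, nat \<lceil>2 / c\<rceil>, nat \<lceil>5 / \<gamma>\<rceil>, nat \<lceil>2 * C / (\<delta>\<^sup>2 * \<eta>)\<rceil>, 1}"
  have \<delta>: "\<delta> > 0" unfolding \<delta>_def using \<gamma> by simp
  have l: "2 / \<delta> \<le> l" "l > 0" unfolding l_def using \<delta> by (auto intro: real_nat_ceiling_ge)
  have L: "L > 0" unfolding L_def using l by simp
  have T: "2 * L * C / (\<gamma> * (\<delta> / 2)\<^sup>2) \<le> T" "T > 0"
    unfolding T_def using real_nat_ceiling_ge[of "2 * L * C / (\<gamma> * (\<delta> / 2)\<^sup>2)"] by auto
  have c: "c > 0" unfolding c_def using \<gamma> L by simp
  have \<gamma>': "\<gamma>' > 0" "\<gamma>' \<le> \<gamma> / 10" "\<gamma>' \<le> c / 2" unfolding \<gamma>'_def using \<gamma> c by auto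
  have "\<exists>S F W. S \<subseteq> V \<and> card S = n \<and> F \<subseteq> [S]\<^bsup>2\<^esup> \<and> W \<subseteq> V - S \<and>
       card V < card W + card F + n \<and> (\<forall>w\<in>W. \<forall>e\<in>F. \<exists>a\<in>e. R a w) \<and>
       card W < ((real q - 1) / 2 + \<eta>) * (real n)\<^sup>2"
    if n: "n \<ge> n0" and R: "symp R" and finV: "finite V" and blue: "\<not> blue_subdiv R n V"
      and V_ge: "((real q - 1) / 2 + \<eta>) * (real n)\<^sup>2 \<le> card V" and V_le: "card V \<le> C * (real n)\<^sup>2"
      and nrich: "\<not> rich R (\<gamma>' * (real n)\<^sup>2) (Suc q) V"
    for n and R :: "nat \<Rightarrow> nat \<Rightarrow> bool" and V
  proof -
    have ns: "n1 \<le> n" "nat \<lceil>2 / c\<rceil> \<le> n" "nat \<lceil>5 / \<gamma>\<rceil> \<le> n" "nat \<lceil>2 * C / (\<delta>\<^sup>2 * \<eta>)\<rceil> \<le> n" "1 \<le> n"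
      using n unfolding n0_def by auto
    have n_real: "2 / c \<le> n" "5 / \<gamma> \<le> n" "2 * C / (\<delta>\<^sup>2 * \<eta>) \<le> n"
      using ns real_nat_ceiling_ge order_trans of_nat_mono by metis+
    define N where "N = (real n)\<^sup>2"
    have N: "N > 0" unfolding N_def using ns by simp
    have n_small: "5 * real n \<le> \<gamma> * N" "2 * C * n \<le> \<delta>\<^sup>2 * \<eta> * N"
    proof -
      have "5 \<le> \<gamma> * n" using n_real(2) \<gamma> by (simp add: field_simps)
      then show "5 * real n \<le> \<gamma> * N"
        unfolding N_def power2_eq_square using mult_right_mono[of 5 "\<gamma> * n" n] by (simp add: mult_ac)
      have "2 * C \<le> \<delta>\<^sup>2 * \<eta> * n" using n_real(3) \<delta> assms(3) by (simp add: field_simps)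
      then show "2 * C * n \<le> \<delta>\<^sup>2 * \<eta> * N"
        unfolding N_def power2_eq_square[of "real n"]
        using mult_right_mono[of "2 * C" "\<delta>\<^sup>2 * \<eta> * n" n] by (simp add: mult_ac)
    qed
    have "((real q - 1) / 2 + \<eta> / 2) * (real n)\<^sup>2 \<le> ((real q - 1) / 2 + \<eta>) * (real n)\<^sup>2"
      using assms(3) by (intro mult_right_mono) auto
    then have "rich R (\<gamma> * N) q V"
      unfolding N_def using ab[OF ns(1) R finV blue _ V_le] V_ge by linarith
    moreover obtain q' where q': "q = Suc q'" using assms(2) gr0_implies_Suc by blast
    moreover have "\<gamma>' * N < \<gamma> * N" using \<gamma>'(2) \<gamma> N by simp
    ultimately obtain Z where Z: "Z \<subseteq> V" "\<gamma> * N \<le> card Z"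
        "card {z \<in> Z. \<gamma>' * N \<le> card {x \<in> Z. R z x}} < \<gamma>' * N"
      using rich_sparse_subset[of R "\<gamma> * N" q' V "\<gamma>' * N"] nrich finV unfolding N_def by blast
    have finZ: "finite Z" using Z(1) finV finite_subset by blast
    define A0 where "A0 = {z \<in> Z. \<not> \<gamma>' * N \<le> card {x \<in> Z. R z x}}"
    have A0: "A0 \<subseteq> V" "finite A0" unfolding A0_def using Z(1) finZ by auto
    have "card Z = card A0 + card {z \<in> Z. \<gamma>' * N \<le> card {x \<in> Z. R z x}}"
      unfolding A0_def using finZ by (subst card_Un_disjoint[symmetric]) (auto intro: arg_cong[where f = card])
    then have card_A0: "9 / 10 * \<gamma> * N \<le> card A0"
      using Z(2,3) mult_right_mono[OF \<gamma>'(2), of N] N by linarith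
    have sparse: "card {x \<in> A0. R a x} \<le> \<gamma> / 10 * N" if "a \<in> A0" for a
    proof -
      have "card {x \<in> A0. R a x} \<le> card {x \<in> Z. R a x}"
        unfolding A0_def using finZ by (intro card_mono) auto
      moreover have "card {x \<in> Z. R a x} < \<gamma>' * N" using that unfolding A0_def by simp
      ultimately show ?thesis using mult_right_mono[OF \<gamma>'(2), of N] N by linarith
    qed
    define m where "m = nat \<lfloor>c * n\<rfloor>"
    have "2 \<le> c * n" using n_real(1) c by (simp add: field_simps)
    then have m: "real m \<le> c * n" "c * n / 2 \<le> m" "m > 0"
      unfolding m_def by linarith+
    \<comment> \<open>A block size divisible by \<open>n\<close>, so that \<open>A\<close> can be cut into \<open>n\<close> equal groups for sampling.\<close>
    define s where "s = n * m"
    have s: "s > 0" unfolding s_def using ns m by simp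
    have "real s \<le> c * N" unfolding s_def N_def power2_eq_square using mult_left_mono[OF m(1), of n]
      by (simp add: mult_ac)
    then have "real s * real (L ^ T) \<le> c * N * real (L ^ T)" by (intro mult_right_mono) auto
    also have "\<dots> = \<gamma> / 2 * N" unfolding c_def using L by simp
    also have "\<dots> \<le> card A0" using card_A0 \<gamma> N mult_pos_pos[OF \<gamma> N] by linarith
    finally have "real (s * L ^ T) \<le> real (card A0)" by simp
    then have "s * L ^ T \<le> card A0" by (simp only: of_nat_le_iff)
    from regular_subset[OF finV A0(2) L T(2) s this, where R = R]
    obtain A k where A: "A \<subseteq> A0" "card A = L * (s * L ^ k)" and reg: "\<forall>X\<subseteq>A. X \<noteq> {} \<and>
        s * L ^ k dvd card X \<longrightarrow>
        (\<Sum>w\<in>V. (nbr_density R w X - nbr_density R w A)\<^sup>2) \<le> L * card V / T"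
      by (elim exE conjE)
    define s' where "s' = s * L ^ k"
    have s': "s' > 0" "\<gamma>' * N \<le> s'"
    proof -
      show "s' > 0" unfolding s'_def using s L by simp
      have "s \<le> s'" unfolding s'_def using L by simp
      then have "real s \<le> real s'" by simp
      moreover have "c / 2 * N \<le> s"
        unfolding s_def N_def power2_eq_square using mult_left_mono[OF m(2), of n] by (simp add: mult_ac)
      moreover have "\<gamma>' * N \<le> c / 2 * N" using \<gamma>'(3) N by (intro mult_right_mono) auto
      ultimately show "\<gamma>' * N \<le> s'" by linarith
    qed
    have finA: "finite A" using A(1) A0(2) finite_subset by blast
    define P where "P = {w \<in> V. \<delta> \<le> nbr_density R w A}"
    have few: "card {w \<in> P. card {x \<in> X. R w x} < l ^ i * s'} \<le> \<gamma> / 2 * N"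
      if "i < q" "X \<subseteq> A" "card X = l ^ Suc i * s'" for i X
    proof -
      have cX: "card X = l * (l ^ i * s')" using that(3) by simp
      have "X \<noteq> {}" using cX l(2) s'(1) by auto
      then have "(\<Sum>w\<in>V. (nbr_density R w X - nbr_density R w A)\<^sup>2) \<le> L * card V / T"
        using reg[rule_format, of X] that(2,3) unfolding s'_def by simp
      then have "card {w \<in> P. card {x \<in> X. R w x} < l ^ i * s'} \<le> L * card V / T / (\<delta> / 2)\<^sup>2"
        unfolding P_def using l(2) s'(1)
        by (intro few_atypical[OF finV cX _ l(2) l(1) \<delta>]) simp_all
      also have "\<dots> \<le> L * (C * N) / T / (\<delta> / 2)\<^sup>2"
        using V_le unfolding N_def of_nat_mult by (intro divide_right_mono mult_left_mono) auto
      also have "\<dots> \<le> \<gamma> / 2 * N"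
      proof -
        have "2 * L * C \<le> T * (\<gamma> * (\<delta> / 2)\<^sup>2)" using T(1) \<gamma> \<delta> by (simp add: divide_le_eq)
        then have "2 * L * C * N \<le> T * (\<gamma> * (\<delta> / 2)\<^sup>2) * N" using N by (intro mult_right_mono) auto
        then have "L * (C * N) \<le> \<gamma> / 2 * N * (T * (\<delta> / 2)\<^sup>2)" by (simp add: mult_ac)
        then show ?thesis using T(2) \<delta> by (simp only: divide_divide_eq_left) (simp add: pos_divide_le_eq)
      qed
      finally show ?thesis .
    qed
    define g where "g = L * (m * L ^ k)"
    have g: "g > 0" "card A = n * g" unfolding g_def using m(3) L A(2) by (auto simp: s_def)
    from sample_subset[OF finV finA g(2,1), where R = R]
    obtain S where S: "S \<subseteq> A" "card S = n"
        "(\<Sum>w\<in>V. (real (card {x \<in> S. R w x}) - card {x \<in> A. R w x} / g)\<^sup>2) \<le> n * card V"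
      by (elim exE conjE)
    have finS: "finite S" using S(1) finA finite_subset by blast
    have SV: "S \<subseteq> V" using S(1) A(1) A0(1) by blast
    from hall_violator[OF finV SV S(2) blue]
    obtain F W where FW: "F \<subseteq> [S]\<^bsup>2\<^esup>" "W \<subseteq> V - S" "card V < card W + card F + n"
        "\<forall>w\<in>W. \<forall>e\<in>F. \<exists>a\<in>e. R a w"
      by (elim exE conjE)
    have finW: "finite W" using FW(2) finV finite_subset by blast
    have "card A0 - 2 * (\<gamma> / 10 * N) - n \<le> card F"
      using violator_has_many_pairs[OF finV A0(1) _ S(2) sparse FW] S(1) A(1) by blast
    then have card_F: "\<gamma> / 2 * N \<le> card F"
      using card_A0 n_small(1) mult_pos_pos[OF \<gamma> N] by linarith
    have deg_W: "2 * \<delta> * n \<le> card {x \<in> S. R w x}" if "w \<in> W" for w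
    proof -
      have "card F \<le> card {x \<in> S. R w x} * card S"
      proof (rule card_edges_le_cover[OF finS FW(1)])
        show "\<forall>e\<in>F. \<exists>a\<in>e. a \<in> {x \<in> S. R w x}"
        proof
          fix e assume e: "e \<in> F"
          from FW(4)[THEN bspec, OF that, THEN bspec, OF e]
          obtain a where a: "a \<in> e" "R a w" by (rule bexE)
          have "e \<in> [S]\<^bsup>2\<^esup>" using FW(1) e by (rule subsetD)
          then have "a \<in> S" using a(1) unfolding nsets_def by blast
          then show "\<exists>a\<in>e. a \<in> {x \<in> S. R w x}" using a sympD[OF R] by blast
        qed
      qed blast
      then have "real (card F) \<le> card {x \<in> S. R w x} * real n"
        using S(2) by (metis of_nat_le_iff of_nat_mult)
      then have "2 * \<delta> * n * n \<le> card {x \<in> S. R w x} * real n"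
        using card_F unfolding N_def \<delta>_def by (simp add: power2_eq_square)
      then show ?thesis using ns(5) by simp
    qed
    have "card W < ((real q - 1) / 2 + \<eta>) * (real n)\<^sup>2"
    proof (rule ccontr)
      assume "\<not> ?thesis"
      then have W_ge: "((real q - 1) / 2 + \<eta>) * N \<le> card W" unfolding N_def by simp
      have "W - P \<subseteq> {w \<in> V. \<delta> * n \<le> \<bar>real (card {x \<in> S. R w x}) - card {x \<in> A. R w x} / g\<bar>}"
      proof
        fix w assume w: "w \<in> W - P"
        then have "nbr_density R w A < \<delta>" "w \<in> V" using FW(2) unfolding P_def by auto
        moreover have "card {x \<in> A. R w x} / g = n * nbr_density R w A"
          unfolding nbr_density_def g(2) using ns(5) by simp
        ultimately have "card {x \<in> A. R w x} / g \<le> \<delta> * n"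
          using mult_left_mono[of "nbr_density R w A" \<delta> "real n"] by (simp add: mult.commute)
        then show "w \<in> {w \<in> V. \<delta> * n \<le> \<bar>real (card {x \<in> S. R w x}) - card {x \<in> A. R w x} / g\<bar>}"
          using deg_W[of w] w \<open>w \<in> V\<close> by auto
      qed
      then have "card (W - P) \<le> card {w \<in> V. \<delta> * n \<le> \<bar>real (card {x \<in> S. R w x}) - card {x \<in> A. R w x} / g\<bar>}"
        using finV by (intro card_mono) auto
      also have "real \<dots> \<le> n * card V / (\<delta> * n)\<^sup>2"
        using S(3) \<delta> ns(5) finV by (intro card_large_deviation) auto
      also have "\<dots> \<le> n * (C * N) / (\<delta> * n)\<^sup>2"
        using V_le unfolding N_def of_nat_mult by (intro divide_right_mono mult_left_mono) auto
      also have "\<dots> = C * n / \<delta>\<^sup>2" unfolding N_def power_mult_distrib using ns(5) by simp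
      also have "\<dots> \<le> \<eta> / 2 * N" using n_small(2) \<delta> by (simp add: divide_le_eq mult_ac)
      finally have "card (W - P) \<le> \<eta> / 2 * N" by simp
      moreover have "card W = card (W \<inter> P) + card (W - P)"
        using finW by (metis card_Int_Diff)
      ultimately have WP_ge: "((real q - 1) / 2 + \<eta> / 2) * (real n)\<^sup>2 \<le> card (W \<inter> P)"
        using W_ge unfolding N_def by (simp add: algebra_simps)
      have WP: "W \<inter> P \<subseteq> V" using FW(2) by blast
      then have "card (W \<inter> P) \<le> card V" using finV by (intro card_mono)
      then have "card (W \<inter> P) \<le> C * (real n)\<^sup>2" using V_le by linarith
      then have "rich R (\<gamma> * N) q (W \<inter> P)"
        unfolding N_def using ab[OF ns(1) R _ _ WP_ge] finW blue_subdiv_mono[OF _ WP] blue by blast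
      then have "rich R (\<gamma>' * N) (Suc q) V"
      proof (rule rich_extend[where q = q and P = P and A = A and X = A and l = l and s = s', rotated 5])
        show "card A = l ^ q * s'" using A(2) unfolding L_def s'_def by simp
        show "\<gamma>' * N + \<gamma> / 2 * N \<le> \<gamma> * N"
          using mult_right_mono[OF \<gamma>'(2), of N] mult_pos_pos[OF \<gamma> N] N by linarith
        show "finite P" unfolding P_def using finV by simp
      qed (use finV WP A(1) A0(1) few s'(2) in auto)
      then show False using nrich unfolding N_def by simp
    qed
    then show ?thesis using SV S(2) FW by blast
  qed
  then show ?thesis using \<gamma>'(1) by blast
qed

section \<open>Induction on the clique size\<close>

lemma real_choose_two: "real (n choose 2) = real n * (real n - 1) / 2"
  by (cases n) (simp_all add: choose_two real_of_nat_div algebra_simps)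

text \<open>A violator has at most \<open>n choose 2\<close> pairs, so \<open>W\<close> misses only about \<open>n\<^sup>2 / 2\<close> vertices of \<open>V\<close> and would be
  larger than \<open>small_blocked_set\<close> permits.\<close>

lemma abundant_Suc:
  assumes "abundant q" "q > 0"
  shows "abundant (Suc q)"
  unfolding abundant_def
proof (intro allI impI)
  fix \<eta> C :: real
  assume \<eta>: "\<eta> > 0" and C: "C > 0"
  from small_blocked_set[OF assms half_gt_zero[OF \<eta>] C]
  obtain \<gamma> n1 where \<gamma>: "\<gamma> > 0" and *: "\<forall>n\<ge>n1. \<forall>(R :: nat \<Rightarrow> nat \<Rightarrow> bool) V.
     symp R \<longrightarrow> finite V \<longrightarrow> \<not> blue_subdiv R n V \<longrightarrow>
     ((real q - 1) / 2 + \<eta> / 2) * (real n)\<^sup>2 \<le> card V \<longrightarrow> card V \<le> C * (real n)\<^sup>2 \<longrightarrow>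
     \<not> rich R (\<gamma> * (real n)\<^sup>2) (Suc q) V \<longrightarrow>
     (\<exists>S F W. S \<subseteq> V \<and> card S = n \<and> F \<subseteq> [S]\<^bsup>2\<^esup> \<and> W \<subseteq> V - S \<and>
       card V < card W + card F + n \<and> (\<forall>w\<in>W. \<forall>e\<in>F. \<exists>a\<in>e. R a w) \<and>
       card W < ((real q - 1) / 2 + \<eta> / 2) * (real n)\<^sup>2)"
    by (elim exE conjE)
  define n0 where "n0 = max n1 (nat \<lceil>1 / \<eta>\<rceil>)"
  have "rich R (\<gamma> * (real n)\<^sup>2) (Suc q) V"
    if n: "n \<ge> n0" and R: "symp R" and V: "finite V" "\<not> blue_subdiv R n V"
      and V_ge: "((real (Suc q) - 1) / 2 + \<eta>) * (real n)\<^sup>2 \<le> card V"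
      and V_le: "card V \<le> C * (real n)\<^sup>2"
    for n and R :: "nat \<Rightarrow> nat \<Rightarrow> bool" and V
  proof (rule ccontr)
    assume nrich: "\<not> rich R (\<gamma> * (real n)\<^sup>2) (Suc q) V"
    have n1: "n \<ge> n1" using n unfolding n0_def by simp
    have "1 / \<eta> \<le> n"
      using n real_nat_ceiling_ge[of "1 / \<eta>"] unfolding n0_def by linarith
    then have "1 \<le> \<eta> * n" using \<eta> by (simp add: field_simps)
    then have "1 * real n \<le> \<eta> * n * n" by (intro mult_right_mono) auto
    then have n_small: "n \<le> \<eta> * (real n)\<^sup>2" by (simp add: power2_eq_square)
    have "((real q - 1) / 2 + \<eta> / 2) * (real n)\<^sup>2 \<le> ((real (Suc q) - 1) / 2 + \<eta>) * (real n)\<^sup>2"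
      using \<eta> by (intro mult_right_mono) (auto simp: field_simps)
    then have "((real q - 1) / 2 + \<eta> / 2) * (real n)\<^sup>2 \<le> card V" using V_ge by linarith
    from *[rule_format, OF n1 R V this V_le nrich]
    obtain S F W where SFW: "S \<subseteq> V" "card S = n" "F \<subseteq> [S]\<^bsup>2\<^esup>" "W \<subseteq> V - S"
        "card V < card W + card F + n" "\<forall>w\<in>W. \<forall>e\<in>F. \<exists>a\<in>e. R a w"
        "card W < ((real q - 1) / 2 + \<eta> / 2) * (real n)\<^sup>2"
      by (elim exE conjE)
    have finS: "finite S" using SFW(1) V(1) by (rule finite_subset)
    have "card F \<le> card ([S]\<^bsup>2\<^esup>)"
      using SFW(3) finS by (intro card_mono) (auto simp: finite_imp_finite_nsets)
    then have "card F \<le> n choose 2" using SFW(2) by simp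
    then have "real (card F) \<le> real n * (real n - 1) / 2"
      using real_choose_two[of n] by linarith
    moreover have "real (card V) < card W + card F + n" using SFW(5) by linarith
    moreover have "((real q - 1) / 2 + \<eta> / 2) * (real n)\<^sup>2
        = q * (real n)\<^sup>2 / 2 - (real n)\<^sup>2 / 2 + \<eta> * (real n)\<^sup>2 / 2"
      "((real (Suc q) - 1) / 2 + \<eta>) * (real n)\<^sup>2 = q * (real n)\<^sup>2 / 2 + \<eta> * (real n)\<^sup>2"
      "real n * (real n - 1) / 2 = (real n)\<^sup>2 / 2 - n / 2"
      by (simp_all add: field_simps power2_eq_square)
    ultimately show False
      using SFW(7) V_ge n_small by linarith
  qed
  then show "\<exists>\<gamma>>0. \<exists>n0. \<forall>n\<ge>n0. \<forall>(R :: nat \<Rightarrow> nat \<Rightarrow> bool) V.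
     symp R \<longrightarrow> finite V \<longrightarrow> \<not> blue_subdiv R n V \<longrightarrow>
     ((real (Suc q) - 1) / 2 + \<eta>) * (real n)\<^sup>2 \<le> card V \<longrightarrow> card V \<le> C * (real n)\<^sup>2 \<longrightarrow>
     rich R (\<gamma> * (real n)\<^sup>2) (Suc q) V"
    using \<gamma> by (intro exI[of _ \<gamma>] conjI exI[of _ n0]) auto
qed

lemma abundant_holds:
  assumes "q > 0"
  shows "abundant q"
  using assms
proof (induction q rule: nat_induct_non_zero)
  case 1
  show ?case
    unfolding abundant_def
  proof (intro allI impI)
    fix \<eta> C :: real
    assume "\<eta> > 0"
    then show "\<exists>\<gamma>>0. \<exists>n0. \<forall>n\<ge>n0. \<forall>(R :: nat \<Rightarrow> nat \<Rightarrow> bool) V.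
       symp R \<longrightarrow> finite V \<longrightarrow> \<not> blue_subdiv R n V \<longrightarrow>
       ((real 1 - 1) / 2 + \<eta>) * (real n)\<^sup>2 \<le> card V \<longrightarrow> card V \<le> C * (real n)\<^sup>2 \<longrightarrow>
       rich R (\<gamma> * (real n)\<^sup>2) 1 V"
      by (intro exI[of _ \<eta>]) auto
  qed
next
  case (Suc q)
  then show ?case using abundant_Suc by blast
qed

text \<open>Colour \<open>a \<in> S\<close> with a vertex of \<open>Q\<close> to which it is not red. A monochromatic pair is not blocked by its
  colour, so it is not in \<open>F\<close>; \<open>i\<close> is the size of the largest colour class.\<close>

lemma clique_colours_blocked_pairs:
  assumes "finite S" "finite Q" "Q \<noteq> {}" "F \<subseteq> [S]\<^bsup>2\<^esup>"
    and block: "\<forall>w\<in>Q. \<forall>e\<in>F. \<exists>a\<in>e. R a w"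
    and cover: "\<forall>a\<in>S. \<exists>w\<in>Q. \<not> R a w"
  shows "\<exists>i. card S \<le> card Q * i \<and> card F + (i choose 2) \<le> card S choose 2"
proof -
  define I where "I w = {a \<in> S. \<not> R a w}" for w
  have finI: "finite (I w)" "I w \<subseteq> S" for w unfolding I_def using assms(1) by auto
  have "S = (\<Union>w\<in>Q. I w)" unfolding I_def using cover by blast
  then have "card S \<le> (\<Sum>w\<in>Q. card (I w))" using card_UN_le[OF assms(2), of I] by simp
  moreover have "Max ((\<lambda>v. card (I v)) ` Q) \<in> (\<lambda>v. card (I v)) ` Q"
    using assms(2,3) by (intro Max_in) auto
  then obtain w where w: "w \<in> Q" "card (I w) = Max ((\<lambda>v. card (I v)) ` Q)" by auto
  moreover have "(\<Sum>v\<in>Q. card (I v)) \<le> card Q * card (I w)"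
    using sum_bounded_above[of Q "\<lambda>v. card (I v)" "card (I w)"] assms(2) w(2) by simp
  ultimately have large: "card S \<le> card Q * card (I w)" by linarith
  have fin2: "finite ([S]\<^bsup>2\<^esup>)" using assms(1) by (simp add: finite_imp_finite_nsets)
  have "F \<inter> [I w]\<^bsup>2\<^esup> = {}"
  proof (rule ccontr)
    assume "F \<inter> [I w]\<^bsup>2\<^esup> \<noteq> {}"
    then obtain e where e: "e \<in> F" "e \<in> [I w]\<^bsup>2\<^esup>" by blast
    from block[THEN bspec, OF w(1), THEN bspec, OF e(1)]
    obtain a where "a \<in> e" "R a w" by (rule bexE)
    moreover have "e \<subseteq> I w" using e(2) unfolding nsets_def by blast
    ultimately show False unfolding I_def by blast
  qed
  then have "card F + card ([I w]\<^bsup>2\<^esup>) = card (F \<union> [I w]\<^bsup>2\<^esup>)"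
    using finite_subset[OF assms(4) fin2] finI(1)
    by (subst card_Un_disjoint) (simp_all add: finite_imp_finite_nsets)
  also have "\<dots> \<le> card ([S]\<^bsup>2\<^esup>)"
    using assms(4) nsets_mono[OF finI(2)] fin2 by (intro card_mono) auto
  finally have "card F + (card (I w) choose 2) \<le> card S choose 2" by simp
  then show ?thesis using large by blast
qed

lemma extend_clique:
  assumes "symp R" "Q \<subseteq> V" "card Q = q" "q > 0" "\<forall>x\<in>Q. \<forall>y\<in>Q. x \<noteq> y \<longrightarrow> R x y"
    and "a \<in> V - Q" "\<forall>w\<in>Q. R a w"
  shows "\<exists>Q\<subseteq>V. card Q = Suc q \<and> (\<forall>x\<in>Q. \<forall>y\<in>Q. x \<noteq> y \<longrightarrow> R x y)"
proof (intro exI conjI)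
  have "finite Q" using assms(3,4) by (metis card.infinite less_nat_zero_code)
  then show "card (insert a Q) = Suc q" using assms(3,6) by simp
  show "insert a Q \<subseteq> V" using assms(2,6) by blast
  show "\<forall>x\<in>insert a Q. \<forall>y\<in>insert a Q. x \<noteq> y \<longrightarrow> R x y"
    using assms(5,7) sympD[OF assms(1)] by blast
qed

text \<open>With \<open>f\<close> pairs, \<open>w\<close> blocked vertices and a colour class of size \<open>i\<close> at least \<open>n / q\<close>, the \<open>i choose 2\<close>
  missing pairs contribute about \<open>n\<^sup>2 / (2 q\<^sup>2)\<close> to \<open>w\<close>, twice the claimed excess over \<open>(q - 1) n\<^sup>2 / 2\<close>.\<close>

lemma blocked_set_large:
  fixes n q i f w v :: nat
  assumes "q > 0" "n \<ge> 2 * q" "n \<le> q * i" "f + (i choose 2) \<le> n choose 2"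
    and "v = q * (n + (n choose 2) - 1) + 1" "v < w + f + n"
  shows "((real q - 1) / 2 + 1 / (4 * (real q)\<^sup>2)) * (real n)\<^sup>2 \<le> w"
proof -
  define x where "x = real n / q"
  have n: "real n = q * x" unfolding x_def using assms(1) by simp
  have "real (2 * q) \<le> real n" using assms(2) by (simp only: of_nat_le_iff)
  then have x2: "2 \<le> x" unfolding x_def using assms(1) by (simp add: field_simps)
  have "real n \<le> real (q * i)" using assms(3) by (simp only: of_nat_le_iff)
  then have "x \<le> i" unfolding x_def using assms(1) by (simp add: field_simps)
  then have "x * (x - 1) \<le> i * (real i - 1)" using x2 by (intro mult_mono) auto
  then have i: "x * (x - 1) / 2 \<le> i choose 2" using real_choose_two[of i] by simp
  have "n > 0" using assms(1,2) by simp
  then have v: "real v = q * (n + real n * (real n - 1) / 2 - 1) + 1"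
    using assms(5) by (simp add: of_nat_diff real_choose_two)
  have f: "f + real (i choose 2) \<le> real n * (real n - 1) / 2"
    using assms(4) real_choose_two[of n] by linarith
  have "real v < w + f + n" using assms(6) by linarith
  then have "q * (n + real n * (real n - 1) / 2 - 1) + 1 - n - real n * (real n - 1) / 2 + x * (x - 1) / 2 \<le> w"
    using v f i by linarith
  moreover have "((real q - 1) / 2 + 1 / (4 * (real q)\<^sup>2)) * (real n)\<^sup>2
      = (real q - 1) * (real n)\<^sup>2 / 2 + x\<^sup>2 / 4"
    unfolding x_def using assms(1) by (simp add: field_simps power2_eq_square)
  moreover have "q * (n + real n * (real n - 1) / 2 - 1) + 1 - n - real n * (real n - 1) / 2
      = (real q - 1) * (real n)\<^sup>2 / 2 + (real q - 1) * (n / 2 - 1)"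
    by (simp add: field_simps power2_eq_square)
  moreover have "0 \<le> (real q - 1) * (n / 2 - 1)"
    using assms(1,2) by (intro mult_nonneg_nonneg) auto
  moreover have "2 * x \<le> x * x" using x2 by (intro mult_right_mono) auto
  then have "x\<^sup>2 / 4 \<le> x * (x - 1) / 2" by (simp add: power2_eq_square algebra_simps)
  ultimately show ?thesis by linarith
qed

text \<open>The violator leaves \<open>|W| > (q - 1) (N - 1)\<close>, exactly enough for the induction hypothesis. The red
  \<open>K\<^sub>q\<close> it provides forces \<open>F\<close> to be sparser, and then \<open>W\<close> is larger than \<open>small_blocked_set\<close> permits.\<close>

lemma red_clique_or_blue_subdiv:
  assumes "q > 0"
  shows "\<exists>n0. \<forall>n\<ge>n0. \<forall>(R :: nat \<Rightarrow> nat \<Rightarrow> bool) V. symp R \<longrightarrow> irreflp R \<longrightarrow> finite V \<longrightarrow>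
    (q - 1) * (n + (n choose 2) - 1) + 1 \<le> card V \<longrightarrow>
    blue_subdiv R n V \<or> (\<exists>Q\<subseteq>V. card Q = q \<and> (\<forall>x\<in>Q. \<forall>y\<in>Q. x \<noteq> y \<longrightarrow> R x y))"
  using assms
proof (induction q rule: nat_induct_non_zero)
  case 1
  have "\<exists>Q\<subseteq>V. card Q = 1 \<and> (\<forall>x\<in>Q. \<forall>y\<in>Q. x \<noteq> y \<longrightarrow> R x y)" if "1 \<le> card V"
    for V and R :: "nat \<Rightarrow> nat \<Rightarrow> bool"
  proof -
    obtain v where "v \<in> V" using \<open>1 \<le> card V\<close> by (cases "V = {}") auto
    then show ?thesis by (intro exI[of _ "{v}"]) auto
  qed
  then show ?case by simp
next
  case (Suc q)
  then obtain n1 where n1: "\<forall>n\<ge>n1. \<forall>(R :: nat \<Rightarrow> nat \<Rightarrow> bool) V. symp R \<longrightarrow> irreflp R \<longrightarrow> finite V \<longrightarrow>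
    (q - 1) * (n + (n choose 2) - 1) + 1 \<le> card V \<longrightarrow>
    blue_subdiv R n V \<or> (\<exists>Q\<subseteq>V. card Q = q \<and> (\<forall>x\<in>Q. \<forall>y\<in>Q. x \<noteq> y \<longrightarrow> R x y))"
    by (elim exE)
  define \<eta> where "\<eta> = 1 / (4 * (real q)\<^sup>2)"
  have \<eta>: "\<eta> > 0" "\<eta> \<le> 1 / 4"
  proof -
    have "1 \<le> (real q)\<^sup>2" using Suc.hyps by simp
    then show "\<eta> \<le> 1 / 4" unfolding \<eta>_def by (intro frac_le) auto
    show "\<eta> > 0" unfolding \<eta>_def using Suc.hyps by simp
  qed
  have C: "0 < real q + 1" by simp
  from small_blocked_set[OF abundant_holds[OF Suc.hyps] Suc.hyps \<eta>(1) C]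
  obtain \<gamma> n2 where \<gamma>: "\<gamma> > 0" and *: "\<forall>n\<ge>n2. \<forall>(R :: nat \<Rightarrow> nat \<Rightarrow> bool) V.
     symp R \<longrightarrow> finite V \<longrightarrow> \<not> blue_subdiv R n V \<longrightarrow>
     ((real q - 1) / 2 + \<eta>) * (real n)\<^sup>2 \<le> card V \<longrightarrow> card V \<le> (real q + 1) * (real n)\<^sup>2 \<longrightarrow>
     \<not> rich R (\<gamma> * (real n)\<^sup>2) (Suc q) V \<longrightarrow>
     (\<exists>S F W. S \<subseteq> V \<and> card S = n \<and> F \<subseteq> [S]\<^bsup>2\<^esup> \<and> W \<subseteq> V - S \<and>
       card V < card W + card F + n \<and> (\<forall>w\<in>W. \<forall>e\<in>F. \<exists>a\<in>e. R a w) \<and>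
       card W < ((real q - 1) / 2 + \<eta>) * (real n)\<^sup>2)"
    by (elim exE conjE)
  define n0 where "n0 = Max {n1, n2, 2 * q}"
  have "\<exists>Q\<subseteq>V. card Q = Suc q \<and> (\<forall>x\<in>Q. \<forall>y\<in>Q. x \<noteq> y \<longrightarrow> R x y)"
    if n: "n \<ge> n0" and R: "symp R" "irreflp R" and V: "finite V"
      and V_ge: "q * (n + (n choose 2) - 1) + 1 \<le> card V" and blue: "\<not> blue_subdiv R n V"
    for n and R :: "nat \<Rightarrow> nat \<Rightarrow> bool" and V
  proof -
    have ns: "n1 \<le> n" "n2 \<le> n" "2 * q \<le> n" using n unfolding n0_def by auto
    have n2: "real n \<ge> 2" using ns(3) Suc.hyps by simp
    \<comment> \<open>Fixing the size provides the upper bound on the number of vertices that is required below.\<close>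
    obtain U where U: "U \<subseteq> V" "card U = q * (n + (n choose 2) - 1) + 1"
      using V_ge by (meson obtain_subset_with_card_n)
    have finU: "finite U" using U(1) V by (rule finite_subset)
    have U_blue: "\<not> blue_subdiv R n U" using blue blue_subdiv_mono[OF _ U(1)] by blast
    have cU: "real (card U) = q * (n + real n * (real n - 1) / 2 - 1) + 1"
      unfolding U(2) using n2 by (simp add: of_nat_diff real_choose_two)
    have U_ge: "((real q - 1) / 2 + \<eta>) * (real n)\<^sup>2 \<le> card U"
    proof -
      have "((real q - 1) / 2 + \<eta>) * (real n)\<^sup>2 \<le> real q / 2 * (real n)\<^sup>2"
        using \<eta>(2) by (intro mult_right_mono) (auto simp: field_simps)
      moreover have "real (card U) = real q / 2 * (real n)\<^sup>2 + q * (n / 2 - 1) + 1"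
        unfolding cU by (simp add: field_simps power2_eq_square)
      moreover have "0 \<le> q * (n / 2 - 1)" using n2 by simp
      ultimately show ?thesis by linarith
    qed
    have U_le: "card U \<le> (real q + 1) * (real n)\<^sup>2"
    proof -
      have sq: "2 * n \<le> (real n)\<^sup>2" using mult_right_mono[OF n2, of n] by (simp add: power2_eq_square)
      have "n + real n * (real n - 1) / 2 - 1 \<le> (real n)\<^sup>2"
        using sq by (simp add: field_simps power2_eq_square)
      then have "q * (n + real n * (real n - 1) / 2 - 1) \<le> q * (real n)\<^sup>2"
        by (intro mult_left_mono) auto
      then show ?thesis unfolding cU using sq n2 by (simp add: distrib_right)
    qed
    show ?thesis
    proof (rule ccontr)
      assume no_clique: "\<not> ?thesis"
      have "\<not> rich R (\<gamma> * (real n)\<^sup>2) (Suc q) U"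
      proof
        assume "rich R (\<gamma> * (real n)\<^sup>2) (Suc q) U"
        moreover have "\<gamma> * (real n)\<^sup>2 > 0" using \<gamma> n2 by simp
        ultimately have "\<exists>Q\<subseteq>U. card Q = Suc q \<and> (\<forall>x\<in>Q. \<forall>y\<in>Q. x \<noteq> y \<longrightarrow> R x y)"
          using finU R by (rule rich_imp_clique)
        then show False using no_clique U(1) by (meson order_trans)
      qed
      from *[rule_format, OF ns(2) R(1) finU U_blue U_ge U_le this]
      obtain S F W where SFW: "S \<subseteq> U" "card S = n" "F \<subseteq> [S]\<^bsup>2\<^esup>" "W \<subseteq> U - S"
          "card U < card W + card F + n" "\<forall>w\<in>W. \<forall>e\<in>F. \<exists>a\<in>e. R a w"
          "card W < ((real q - 1) / 2 + \<eta>) * (real n)\<^sup>2"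
        by (elim exE conjE)
      have finS: "finite S" using SFW(1) finU by (rule finite_subset)
      have finW: "finite W" by (rule finite_subset[OF SFW(4)]) (simp add: finU)
      have "card F \<le> card ([S]\<^bsup>2\<^esup>)"
        using SFW(3) finS by (intro card_mono) (auto simp: finite_imp_finite_nsets)
      then have F_le: "card F \<le> n choose 2" using SFW(2) by simp
      have "(q - 1) * (n + (n choose 2) - 1) + 1 \<le> card W"
      proof -
        obtain q' where q': "q = Suc q'" using Suc.hyps gr0_implies_Suc by blast
        show ?thesis using SFW(5) F_le n2 unfolding U(2) q' by simp
      qed
      moreover have "\<not> blue_subdiv R n W"
        using U_blue blue_subdiv_mono[of R n W U] SFW(4) by blast
      ultimately have "\<exists>Q\<subseteq>W. card Q = q \<and> (\<forall>x\<in>Q. \<forall>y\<in>Q. x \<noteq> y \<longrightarrow> R x y)"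
        using n1[rule_format, OF ns(1) R finW] by blast
      then obtain Q where Q: "Q \<subseteq> W" "card Q = q" "\<forall>x\<in>Q. \<forall>y\<in>Q. x \<noteq> y \<longrightarrow> R x y"
        by (elim exE conjE)
      have finQ: "finite Q" using Q(1) finW by (rule finite_subset)
      have QV: "Q \<subseteq> V" using Q(1) SFW(4) U(1) by blast
      have "\<exists>w\<in>Q. \<not> R a w" if "a \<in> S" for a
      proof (rule ccontr)
        assume a: "\<not> ?thesis"
        have "a \<in> V - Q" using that SFW(1,4) U(1) Q(1) by blast
        then show False
          using extend_clique[OF R(1) QV Q(2) Suc.hyps Q(3)] a no_clique by blast
      qed
      then have cover: "\<forall>a\<in>S. \<exists>w\<in>Q. \<not> R a w" by blast
      have block: "\<forall>w\<in>Q. \<forall>e\<in>F. \<exists>a\<in>e. R a w" using SFW(6) Q(1) by (meson subsetD)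
      have "Q \<noteq> {}" using Q(2) Suc.hyps by auto
      from clique_colours_blocked_pairs[OF finS finQ this SFW(3) block cover]
      obtain i where "n \<le> q * i" "card F + (i choose 2) \<le> n choose 2"
        unfolding SFW(2) Q(2) by (elim exE conjE)
      then have "((real q - 1) / 2 + \<eta>) * (real n)\<^sup>2 \<le> card W"
        unfolding \<eta>_def using blocked_set_large[OF Suc.hyps ns(3) _ _ U(2) SFW(5)] by blast
      then show False using SFW(7) by linarith
    qed
  qed
  then show ?case by (intro exI[of _ n0]) auto
qed

section \<open>Ramsey numbers of the subdivision\<close>

lemma simple_graph_subdivision: "simple_graph (subdivide_edges (complete_graph n))"
proof -
  have "v \<in> {..<n}" if "e \<in> [{..<n}]\<^bsup>2\<^esup>" "v \<in> e" for v e
    using that unfolding nsets_def by blast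
  then show ?thesis
    unfolding simple_graph_def subdivide_edges_def complete_graph_def
    by (auto simp: finite_imp_finite_nsets)
qed

lemma graph_order_subdivision:
  "graph_order (subdivide_edges (complete_graph n)) = n + (n choose 2)"
proof -
  have "card (Inl ` {..<n} \<union> Inr ` ([{..<n}]\<^bsup>2\<^esup>) :: (nat + nat set) set)
      = card (Inl ` {..<n} :: (nat + nat set) set) + card (Inr ` ([{..<n}]\<^bsup>2\<^esup>) :: (nat + nat set) set)"
    by (rule card_Un_disjoint) (auto simp: finite_imp_finite_nsets)
  then show ?thesis
    unfolding graph_order_def subdivide_edges_def complete_graph_def
    by (simp add: card_image)
qed

lemma connected_subdivision:
  assumes "n > 0"
  shows "connected_graph (subdivide_edges (complete_graph n))"
proof -
  let ?H = "subdivide_edges (complete_graph n)"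
  define r where "r = {(x, y). {x, y} \<in> edges ?H}"
  have "sym r" unfolding r_def sym_def by (simp add: insert_commute)
  then have sym: "sym (r\<^sup>*)" by (rule sym_rtrancl)
  have edge: "(Inl v, Inr e) \<in> r" if "e \<in> [{..<n}]\<^bsup>2\<^esup>" "v \<in> e" for v e
    using that unfolding r_def subdivide_edges_def complete_graph_def by auto
  have edge': "(Inr e, Inl v) \<in> r" if "e \<in> [{..<n}]\<^bsup>2\<^esup>" "v \<in> e" for v e
    using edge[OF that] \<open>sym r\<close> by (auto dest: symD)
  have branch: "(Inl v, Inl 0) \<in> r\<^sup>*" if "v < n" for v
  proof (cases "v = 0")
    case False
    then have "{v, 0} \<in> [{..<n}]\<^bsup>2\<^esup>" using that by simp
    then have "(Inl v, Inr {v, 0}) \<in> r" "(Inr {v, 0}, Inl 0) \<in> r" using edge edge' by auto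
    then show ?thesis by (rule converse_rtrancl_into_rtrancl[OF _ r_into_rtrancl])
  qed simp
  have root: "(u, Inl 0) \<in> r\<^sup>*" if "u \<in> verts ?H" for u
  proof (cases u)
    case (Inl v)
    then show ?thesis using that branch
      unfolding subdivide_edges_def complete_graph_def by auto
  next
    case (Inr e)
    then have e: "e \<in> [{..<n}]\<^bsup>2\<^esup>"
      using that unfolding subdivide_edges_def complete_graph_def by auto
    then obtain v where v: "v \<in> e" by (metis insertI1 nsets2_E)
    then have "v < n" using e unfolding nsets_def by auto
    then show ?thesis
      using converse_rtrancl_into_rtrancl[OF edge'[OF e v] branch] Inr by simp
  qed
  have "(u, v) \<in> r\<^sup>*" if "u \<in> verts ?H" "v \<in> verts ?H" for u v
    using rtrancl_trans[OF root[OF that(1)] symD[OF sym root[OF that(2)]]] .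
  moreover have "verts ?H \<noteq> {}"
    using assms unfolding subdivide_edges_def complete_graph_def by auto
  ultimately show ?thesis unfolding connected_graph_def r_def by blast
qed

text \<open>Red joins different blocks of \<open>|H| - 1\<close> consecutive numbers. A red clique meets each of the at most
  \<open>p - 1\<close> blocks at most once, and a connected blue graph stays within one block.\<close>

lemma ramsey_lower_bound:
  assumes H: "connected_graph H" and p: "p > 0"
    and ord: "graph_order H \<ge> 2" and m: "ramsey_property (complete_graph p) H m"
  shows "(p - 1) * (graph_order H - 1) + 1 \<le> m"
proof (rule ccontr)
  define k where "k = graph_order H - 1"
  have k: "k > 0" unfolding k_def using ord by simp
  assume "\<not> ?thesis"
  then have m_le: "m \<le> (p - 1) * k" unfolding k_def by simp
  define R :: "nat sgraph" where
    "R = \<lparr>verts = {..<m}, edges = {e \<in> [{..<m}]\<^bsup>2\<^esup>. \<exists>x\<in>e. \<exists>y\<in>e. x div k \<noteq> y div k}\<rparr>"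
  define B :: "nat sgraph" where
    "B = \<lparr>verts = {..<m}, edges = {e \<in> [{..<m}]\<^bsup>2\<^esup>. \<not> (\<exists>x\<in>e. \<exists>y\<in>e. x div k \<noteq> y div k)}\<rparr>"
  have "contains_graph R (complete_graph p) \<or> contains_graph B H"
    using m[unfolded ramsey_property_def, rule_format, of R B]
    unfolding R_def B_def complete_graph_def by auto
  then show False
  proof
    assume "contains_graph R (complete_graph p)"
    then obtain f where f: "inj_on f {..<p}" "f ` {..<p} \<subseteq> {..<m}"
        "\<And>e. e \<in> [{..<p}]\<^bsup>2\<^esup> \<Longrightarrow> f ` e \<in> edges R"
      unfolding contains_graph_def complete_graph_def R_def by auto
    have "inj_on (\<lambda>x. f x div k) {..<p}"
    proof (rule inj_onI, rule ccontr)
      fix x y assume xy: "x \<in> {..<p}" "y \<in> {..<p}" "f x div k = f y div k" "x \<noteq> y"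
      then have "{x, y} \<in> [{..<p}]\<^bsup>2\<^esup>" by simp
      from f(3)[OF this] show False using xy(3) unfolding R_def by auto
    qed
    moreover have "(\<lambda>x. f x div k) ` {..<p} \<subseteq> {..<p - 1}"
    proof
      fix c assume "c \<in> (\<lambda>x. f x div k) ` {..<p}"
      then obtain x where x: "x < p" "c = f x div k" by auto
      then have "f x < (p - 1) * k" using f(2) m_le by fastforce
      then show "c \<in> {..<p - 1}" unfolding x(2) by (simp add: less_mult_imp_div_less)
    qed
    ultimately have "card {..<p} \<le> card {..<p - 1}" by (intro card_inj_on_le) auto
    then show False using p by simp
  next
    assume "contains_graph B H"
    then obtain f where f: "inj_on f (verts H)" "\<And>e. e \<in> edges H \<Longrightarrow> f ` e \<in> edges B"
      unfolding contains_graph_def by blast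
    obtain u where u: "u \<in> verts H" using H unfolding connected_graph_def by blast
    have same_block: "f x div k = f y div k" if "{x, y} \<in> edges H" for x y
    proof -
      have "\<not> (\<exists>a\<in>f ` {x, y}. \<exists>b\<in>f ` {x, y}. a div k \<noteq> b div k)"
        using f(2)[OF that] unfolding B_def sgraph.simps mem_Collect_eq by (rule conjunct2)
      then show ?thesis by blast
    qed
    have "f v div k = f u div k" if "v \<in> verts H" for v
    proof -
      have "(u, v) \<in> {(x, y). {x, y} \<in> edges H}\<^sup>*"
        using H u that unfolding connected_graph_def by blast
      then show ?thesis
      proof (induction rule: rtrancl_induct)
        case (step y z)
        then show ?case using same_block[of y z] by simp
      qed simp
    qed
    moreover have "x div k * k \<le> x" "x < x div k * k + k" for x
      using div_mult_mod_eq[of x k] mod_less_divisor[OF k, of x] by linarith+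
    ultimately have "f ` verts H \<subseteq> {f u div k * k..<f u div k * k + k}"
      by (metis atLeastLessThan_iff image_subsetI)
    then have "card (f ` verts H) \<le> card {f u div k * k..<f u div k * k + k}"
      by (intro card_mono) simp_all
    then have "card (f ` verts H) \<le> k" by simp
    then show False
      using card_image[OF f(1)] ord unfolding k_def graph_order_def by simp
  qed
qed

lemma ramsey_property_subdivisionI:
  assumes dich: "\<And>(r :: nat \<Rightarrow> nat \<Rightarrow> bool) V. symp r \<Longrightarrow> irreflp r \<Longrightarrow> finite V \<Longrightarrow> card V = m \<Longrightarrow>
      blue_subdiv r n V \<or> (\<exists>Q\<subseteq>V. card Q = p \<and> (\<forall>x\<in>Q. \<forall>y\<in>Q. x \<noteq> y \<longrightarrow> r x y))"
  shows "ramsey_property (complete_graph p) (subdivide_edges (complete_graph n)) m"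
  unfolding ramsey_property_def
proof (intro allI impI)
  fix R B :: "nat sgraph"
  assume "verts R = verts (complete_graph m) \<and> verts B = verts (complete_graph m) \<and>
    edges R \<union> edges B = edges (complete_graph m) \<and> edges R \<inter> edges B = {}"
  then have RB: "verts R = {..<m}" "verts B = {..<m}" "edges R \<union> edges B = [{..<m}]\<^bsup>2\<^esup>"
    unfolding complete_graph_def by auto
  define r where "r x y \<longleftrightarrow> {x, y} \<in> edges R" for x y
  have "symp r" unfolding r_def symp_def by (simp add: insert_commute)
  moreover have "irreflp r"
  proof (rule irreflpI)
    fix x
    have "{x, x} \<notin> [{..<m}]\<^bsup>2\<^esup>" by (simp add: nsets_def)
    then show "\<not> r x x" unfolding r_def using RB(3) by blast
  qed
  ultimately have "blue_subdiv r n {..<m} \<or>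
      (\<exists>Q\<subseteq>{..<m}. card Q = p \<and> (\<forall>x\<in>Q. \<forall>y\<in>Q. x \<noteq> y \<longrightarrow> r x y))"
    by (intro dich) auto
  then show "contains_graph R (complete_graph p) \<or>
      contains_graph B (subdivide_edges (complete_graph n))"
  proof
    assume "\<exists>Q\<subseteq>{..<m}. card Q = p \<and> (\<forall>x\<in>Q. \<forall>y\<in>Q. x \<noteq> y \<longrightarrow> r x y)"
    then obtain Q where Q: "Q \<subseteq> {..<m}" "card Q = p" "\<forall>x\<in>Q. \<forall>y\<in>Q. x \<noteq> y \<longrightarrow> r x y"
      by blast
    have "contains_graph R (complete_graph p)"
    proof (rule contains_graph_if_clique)
      show "simple_graph (complete_graph p)" unfolding simple_graph_def complete_graph_def by simp
      show "Q \<subseteq> verts R" using Q(1) RB(1) by simp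
      show "finite Q" using Q(1) by (rule finite_subset) simp
      show "card Q = graph_order (complete_graph p)"
        unfolding graph_order_def complete_graph_def using Q(2) by simp
      show "clique Q (edges R)" unfolding clique_def using Q(3) unfolding r_def by blast
    qed
    then show ?thesis ..
  next
    assume "blue_subdiv r n {..<m}"
    then obtain S \<phi> where S: "S \<subseteq> {..<m}" "card S = n" "inj_on \<phi> ([S]\<^bsup>2\<^esup>)"
        "\<forall>e\<in>[S]\<^bsup>2\<^esup>. \<phi> e \<in> {..<m} - S \<and> (\<forall>a\<in>e. \<not> r a (\<phi> e))"
      unfolding blue_subdiv_def by (elim exE conjE)
    have "finite S" using S(1) by (rule finite_subset) simp
    then obtain g where g: "bij_betw g {..<n} S"
      using S(2) by (metis card_lessThan finite_lessThan finite_same_card_bij)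
    then have g_inj: "inj_on g {..<n}" and g_in: "\<And>v. v < n \<Longrightarrow> g v \<in> S"
      by (auto simp: bij_betw_def)
    have img: "g ` e \<in> [S]\<^bsup>2\<^esup>" if "e \<in> [{..<n}]\<^bsup>2\<^esup>" for e
    proof -
      have "e \<subseteq> {..<n}" "finite e" "card e = 2" using that unfolding nsets_def by auto
      then show ?thesis
        using g_in card_image[OF inj_on_subset[OF g_inj]] unfolding nsets_def by auto
    qed
    have img_inj: "e = e'" if "e \<in> [{..<n}]\<^bsup>2\<^esup>" "e' \<in> [{..<n}]\<^bsup>2\<^esup>" "g ` e = g ` e'" for e e'
      using that inj_on_image_eq_iff[OF g_inj] unfolding nsets_def by auto
    define f where "f z = (case z of Inl v \<Rightarrow> g v | Inr e \<Rightarrow> \<phi> (g ` e))" for z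
    have f_simps: "f (Inl v) = g v" "f (Inr e) = \<phi> (g ` e)" for v e unfolding f_def by simp_all
    have \<phi>_in: "\<phi> (g ` e) \<in> {..<m} - S" if "e \<in> [{..<n}]\<^bsup>2\<^esup>" for e
      using S(4)[THEN bspec, OF img[OF that]] by blast
    have "inj_on f (Inl ` {..<n} \<union> Inr ` ([{..<n}]\<^bsup>2\<^esup>))"
    proof (rule inj_onI)
      fix x y
      assume x: "x \<in> Inl ` {..<n} \<union> Inr ` ([{..<n}]\<^bsup>2\<^esup>)"
        and y: "y \<in> Inl ` {..<n} \<union> Inr ` ([{..<n}]\<^bsup>2\<^esup>)" and eq: "f x = f y"
      show "x = y"
      proof (cases x)
        case x': (Inl v)
        then have v: "v < n" using x by auto
        show ?thesis
        proof (cases y)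
          case (Inl w)
          then show ?thesis using x' y eq v inj_onD[OF g_inj, of v w] by (auto simp: f_simps)
        next
          case (Inr e)
          then have "e \<in> [{..<n}]\<^bsup>2\<^esup>" using y by auto
          then show ?thesis using \<phi>_in[of e] g_in[OF v] eq x' Inr by (simp add: f_simps)
        qed
      next
        case x': (Inr e)
        then have e: "e \<in> [{..<n}]\<^bsup>2\<^esup>" using x by auto
        show ?thesis
        proof (cases y)
          case (Inl w)
          then have "w < n" using y by auto
          then show ?thesis using \<phi>_in[OF e] g_in[of w] eq x' Inl by (simp add: f_simps)
        next
          case (Inr e')
          then have e': "e' \<in> [{..<n}]\<^bsup>2\<^esup>" using y by auto
          have "g ` e = g ` e'"
            using eq x' Inr by (intro inj_onD[OF S(3) _ img[OF e] img[OF e']]) (simp add: f_simps)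
          then show ?thesis using img_inj[OF e e'] x' Inr by simp
        qed
      qed
    qed
    moreover have "f ` (Inl ` {..<n} \<union> Inr ` ([{..<n}]\<^bsup>2\<^esup>)) \<subseteq> {..<m}"
    proof
      fix y assume "y \<in> f ` (Inl ` {..<n} \<union> Inr ` ([{..<n}]\<^bsup>2\<^esup>))"
      then consider v where "v < n" "y = g v" | e where "e \<in> [{..<n}]\<^bsup>2\<^esup>" "y = \<phi> (g ` e)"
        by (auto simp: f_simps)
      then show "y \<in> {..<m}"
      proof cases
        case 1
        then show ?thesis using g_in[of v] S(1) by blast
      next
        case 2
        then show ?thesis using \<phi>_in[of e] by blast
      qed
    qed
    moreover have "f ` {Inl v, Inr e} \<in> edges B" if e: "e \<in> [{..<n}]\<^bsup>2\<^esup>" and v: "v \<in> e" for v e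
    proof -
      have "v < n" using e v unfolding nsets_def by auto
      then have "g v \<in> S" by (rule g_in)
      then have "{g v, \<phi> (g ` e)} \<in> [{..<m}]\<^bsup>2\<^esup>" using \<phi>_in[OF e] S(1) by auto
      moreover have "{g v, \<phi> (g ` e)} \<notin> edges R"
        using S(4)[THEN bspec, OF img[OF e]] v unfolding r_def by blast
      ultimately show ?thesis using RB(3) by (auto simp: f_simps)
    qed
    ultimately have "contains_graph B (subdivide_edges (complete_graph n))"
      unfolding contains_graph_def subdivide_edges_def complete_graph_def
      by (intro exI[of _ f]) (auto simp: RB(2))
    then show ?thesis ..
  qed
qed

theorem mainTheorem8:
  fixes p :: nat
  assumes "p \<ge> 3"
  shows "\<exists>n0. \<forall>n\<ge>n0. p_good p (subdivide_edges (complete_graph n))"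
proof -
  have p: "p > 0" using assms by simp
  from red_clique_or_blue_subdiv[OF p]
  obtain n0 where n0: "\<forall>n\<ge>n0. \<forall>(R :: nat \<Rightarrow> nat \<Rightarrow> bool) V. symp R \<longrightarrow> irreflp R \<longrightarrow> finite V \<longrightarrow>
    (p - 1) * (n + (n choose 2) - 1) + 1 \<le> card V \<longrightarrow>
    blue_subdiv R n V \<or> (\<exists>Q\<subseteq>V. card Q = p \<and> (\<forall>x\<in>Q. \<forall>y\<in>Q. x \<noteq> y \<longrightarrow> R x y))"
    by (elim exE)
  have "p_good p (subdivide_edges (complete_graph n))" if n: "n \<ge> max n0 2" for n
  proof -
    let ?H = "subdivide_edges (complete_graph n)"
    let ?m = "(p - 1) * (graph_order ?H - 1) + 1"
    have conn: "connected_graph ?H" using n by (intro connected_subdivision) simp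
    have "ramsey_property (complete_graph p) ?H ?m"
    proof (rule ramsey_property_subdivisionI)
      fix r :: "nat \<Rightarrow> nat \<Rightarrow> bool" and V :: "nat set"
      assume "symp r" "irreflp r" "finite V" "card V = ?m"
      then show "blue_subdiv r n V \<or> (\<exists>Q\<subseteq>V. card Q = p \<and> (\<forall>x\<in>Q. \<forall>y\<in>Q. x \<noteq> y \<longrightarrow> r x y))"
        using n0[rule_format, of n r V] n by (simp add: graph_order_subdivision)
    qed
    moreover have "graph_order ?H \<ge> 2" using n by (simp add: graph_order_subdivision)
    then have "?m \<le> m" if "ramsey_property (complete_graph p) ?H m" for m
      using ramsey_lower_bound[OF conn p _ that] by blast
    ultimately have "ramsey_number (complete_graph p) ?H = ?m"
      unfolding ramsey_number_def by (rule Least_equality)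
    then show ?thesis
      unfolding p_good_def using conn simple_graph_subdivision by simp
  qed
  then show ?thesis by blast
qed

end
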